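(* Let $(\mathcal X,d)$ be a compact metric space, let $C:\mathcal X\times\mathcal X\to\mathbb R$ be a symmetric, $L$-Lipschitz cost function, and let $\alpha,\beta\in\mathcal P(\mathcal X)$. Let $(\eta_t)_t$ satisfy $0\le\eta_t\le1$ for all $t>0$, $\sum_t\eta_t=\infty$ and $\sum_t\eta_t^2<\infty$. Then the online Sinkhorn algorithm with step sizes $(\eta_t)_t$ and constant batch size $n(t)=n$ yields a sequence $(\hat f_t,\hat g_t)_t$ that reaches a ball centered around $(f^\star,g^\star)$ for the variation norm. Namely, there exist $T>0$ and $A>0$ such that for all $t>T$, almost surely, $$\|\hat f_t-f^\star\|_{\mathrm{var}}+\|\hat g_t-g^\star\|_{\mathrm{var}}\le\frac{A}{\sqrt n}.$$
   Context: $\mathcal C(\mathcal X)$ is the set of continuous real functions on $\mathcal X$, $\mathcal P(\mathcal X)$ the set of probability measures on $\mathcal X$. For $h\in\mathcal C(\mathcal X)$ and $\mu\in\mathcal P(\mathcal X)$ the soft $C$-transform is $T_\mu(h)(\cdot)=-\log\int_{\mathcal X}\exp(h(y)-C(\cdot,y))\,d\mu(y)$ (the regularization parameter is $\varepsilon=1$). The variation norm is $\|f\|_{\mathrm{var}}=\max_x f(x)-\min_x f(x)$ (functions are considered up to additive constants). Optimal potentials: $(f^\star,g^\star)\in\mathcal C(\mathcal X)^2$ is a solution of the dual entropic optimal transport problem $\max_{f,g\in\mathcal C(\mathcal X)}\int f\,d\alpha+\int g\,d\beta-\int\!\!\int e^{f(x)+g(y)-C(x,y)}d\alpha(x)d\beta(y)+1$,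 satisfying $f^\star=T_\beta(g^\star)$ and $g^\star=T_\alpha(f^\star)$ on $\mathcal X$. Online Sinkhorn algorithm with batch sizes $n(t)$: let $(x_i)_i$ be i.i.d. samples from $\alpha$ and $(y_i)_i$ i.i.d. samples from $\beta$; $n_0=0$, $n_{t+1}=n_t+n(t)$; $\hat\alpha_t=\frac1{n(t)}\sum_{i=n_t+1}^{n_{t+1}}\delta_{x_i}$, $\hat\beta_t=\frac1{n(t)}\sum_{i=n_t+1}^{n_{t+1}}\delta_{y_i}$. Initialize from the first batch with zero weights: $e^{-\hat f_1(\cdot)}=\sum_{i=1}^{n_1}e^{-C(\cdot,y_i)}$, $e^{-\hat g_1(\cdot)}=\sum_{i=1}^{n_1}e^{-C(x_i,\cdot)}$. For $t\ge1$, $$e^{-\hat f_{t+1}}=(1-\eta_t)e^{-\hat f_t}+\eta_t e^{-T_{\hat\beta_t}(\hat g_t)},\qquad e^{-\hat g_{t+1}}=(1-\eta_t)e^{-\hat g_t}+\eta_t e^{-T_{\hat\alpha_t}(\hat f_t)}.$$ *)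

theory Defs
  imports "HOL-Probability.Probability"
begin

definition soft_C_transform ::
    "('a::topological_space \<Rightarrow> 'a \<Rightarrow> real) \<Rightarrow> 'a measure \<Rightarrow> ('a \<Rightarrow> real) \<Rightarrow> 'a \<Rightarrow> real" where
  "soft_C_transform C \<mu> h = (\<lambda>x. - ln (LINT y|\<mu>. exp (h y - C x y)))"

(* On a compact space and for continuous f, the supremum and the infimum are attained. *)
definition var_norm :: "('a \<Rightarrow> real) \<Rightarrow> real" where
  "var_norm f = (SUP x. f x) - (INF x. f x)"

definition entropic_dual ::
    "('a::topological_space \<Rightarrow> 'a \<Rightarrow> real) \<Rightarrow> 'a measure \<Rightarrow> 'a measure \<Rightarrow> ('a \<Rightarrow> real) \<Rightarrow> ('a \<Rightarrow> real) \<Rightarrow> real" where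
  "entropic_dual C \<alpha> \<beta> f g =
     (LINT x|\<alpha>. f x) + (LINT y|\<beta>. g y)
       - (LINT y|\<beta>. LINT x|\<alpha>. exp (f x + g y - C x y)) + 1"

definition optimal_potentials ::
    "('a::topological_space \<Rightarrow> 'a \<Rightarrow> real) \<Rightarrow> 'a measure \<Rightarrow> 'a measure \<Rightarrow> ('a \<Rightarrow> real) \<Rightarrow> ('a \<Rightarrow> real) \<Rightarrow> bool" where
  "optimal_potentials C \<alpha> \<beta> f g \<longleftrightarrow>
     continuous_on UNIV f \<and> continuous_on UNIV g \<and>
     (\<forall>f' g'. continuous_on UNIV f' \<longrightarrow> continuous_on UNIV g' \<longrightarrow>
        entropic_dual C \<alpha> \<beta> f' g' \<le> entropic_dual C \<alpha> \<beta> f g) \<and>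
     f = soft_C_transform C \<beta> g \<and> g = soft_C_transform C \<alpha> f"

(* The number of samples drawn before batch t. *)
primrec batch_start :: "(nat \<Rightarrow> nat) \<Rightarrow> nat \<Rightarrow> nat" where
  "batch_start b 0 = 0"
| "batch_start b (Suc t) = batch_start b t + b t"

abbreviation batch :: "(nat \<Rightarrow> nat) \<Rightarrow> nat \<Rightarrow> nat set" where
  "batch b t \<equiv> {batch_start b t + 1..batch_start b (t + 1)}"

(* The normalised sum of Dirac masses at the points x i, for i in batch t,
   as the image of the uniform distribution on the indices. *)
definition empirical :: "(nat \<Rightarrow> nat) \<Rightarrow> (nat \<Rightarrow> 'a::topological_space) \<Rightarrow> nat \<Rightarrow> 'a measure" where
  "empirical b x t = distr (uniform_count_measure (batch b t)) borel x"

(* Iterates are numbered from 1; the value at 0 is a dummy. *)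
fun online_sinkhorn ::
    "('a::topological_space \<Rightarrow> 'a \<Rightarrow> real) \<Rightarrow> (nat \<Rightarrow> real) \<Rightarrow> (nat \<Rightarrow> nat) \<Rightarrow> (nat \<Rightarrow> 'a) \<Rightarrow> (nat \<Rightarrow> 'a)
      \<Rightarrow> nat \<Rightarrow> ('a \<Rightarrow> real) \<times> ('a \<Rightarrow> real)" where
  "online_sinkhorn C \<eta> b x y 0 = (\<lambda>_. 0, \<lambda>_. 0)"
| "online_sinkhorn C \<eta> b x y (Suc 0) =
     (\<lambda>z. - ln (\<Sum>i = 1..batch_start b 1. exp (- C z (y i))),
      \<lambda>z. - ln (\<Sum>i = 1..batch_start b 1. exp (- C (x i) z)))"
| "online_sinkhorn C \<eta> b x y (Suc (Suc k)) =
     (let t = Suc k; (f, g) = online_sinkhorn C \<eta> b x y t in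
       (\<lambda>z. - ln ((1 - \<eta> t) * exp (- f z)
               + \<eta> t * exp (- soft_C_transform C (empirical b y t) g z)),
        \<lambda>z. - ln ((1 - \<eta> t) * exp (- g z)
               + \<eta> t * exp (- soft_C_transform C (empirical b x t) f z))))"

abbreviation sinkhorn_f where
  "sinkhorn_f C \<eta> b x y t \<equiv> fst (online_sinkhorn C \<eta> b x y t)"

abbreviation sinkhorn_g where
  "sinkhorn_g C \<eta> b x y t \<equiv> snd (online_sinkhorn C \<eta> b x y t)"

lemma card_batch: "card (batch b t) = b t"
  by simp

lemma soft_C_transform_empirical:
  fixes h :: "'a::topological_space \<Rightarrow> real"
  assumes h: "continuous_on UNIV h" and C: "\<And>z. continuous_on UNIV (C z)" and b: "b t > 0"
  shows "soft_C_transform C (empirical b x t) h z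
           = - ln ((\<Sum>i\<in>batch b t. exp (h (x i) - C z (x i))) / real (b t))"
    and "exp (- soft_C_transform C (empirical b x t) h z)
           = (\<Sum>i\<in>batch b t. exp (h (x i) - C z (x i))) / real (b t)"
proof -
  have m: "(\<lambda>y. exp (h y - C z y)) \<in> borel_measurable borel"
    by (intro borel_measurable_continuous_onI continuous_intros h C)
  have x: "x \<in> measurable (uniform_count_measure (batch b t)) borel"
    by (simp add: measurable_def)
  have "(LINT y|empirical b x t. exp (h y - C z y))
      = (LINT i|uniform_count_measure (batch b t). exp (h (x i) - C z (x i)))"
    unfolding empirical_def by (rule integral_distr[OF x m])
  also have "\<dots> = (\<Sum>i\<in>batch b t. exp (h (x i) - C z (x i))) / real (b t)"
    unfolding uniform_count_measure_def
    by (subst lebesgue_integral_point_measure_finite)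
       (auto simp: card_batch sum_divide_distrib)
  finally have *: "(LINT y|empirical b x t. exp (h y - C z y))
      = (\<Sum>i\<in>batch b t. exp (h (x i) - C z (x i))) / real (b t)" .
  show "soft_C_transform C (empirical b x t) h z
           = - ln ((\<Sum>i\<in>batch b t. exp (h (x i) - C z (x i))) / real (b t))"
    by (simp add: soft_C_transform_def * del: batch_start.simps)
  have "(\<Sum>i\<in>batch b t. exp (h (x i) - C z (x i))) > 0"
    by (rule sum_pos) (use b in auto)
  then show "exp (- soft_C_transform C (empirical b x t) h z)
           = (\<Sum>i\<in>batch b t. exp (h (x i) - C z (x i))) / real (b t)"
    using b by (simp add: soft_C_transform_def * del: batch_start.simps)
qed

lemma online_sinkhorn_init:
  assumes "b 0 > 0"
  shows "exp (- sinkhorn_f C \<eta> b x y 1 z) = (\<Sum>i = 1..batch_start b 1. exp (- C z (y i)))"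
    and "exp (- sinkhorn_g C \<eta> b x y 1 z) = (\<Sum>i = 1..batch_start b 1. exp (- C (x i) z))"
proof -
  have "(\<Sum>i = 1..batch_start b 1. exp (- C z (y i))) > 0"
       "(\<Sum>i = 1..batch_start b 1. exp (- C (x i) z)) > 0"
    using assms by (auto intro!: sum_pos)
  then show "exp (- sinkhorn_f C \<eta> b x y 1 z) = (\<Sum>i = 1..batch_start b 1. exp (- C z (y i)))"
    and "exp (- sinkhorn_g C \<eta> b x y 1 z) = (\<Sum>i = 1..batch_start b 1. exp (- C (x i) z))"
    by simp_all
qed

lemma convex_exp_pos:
  fixes e :: real
  assumes "0 \<le> e" "e \<le> 1"
  shows "(1 - e) * exp u + e * exp v > 0"
proof (cases "e = 0")
  case False
  with assms show ?thesis by (intro add_nonneg_pos) auto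
qed simp

lemma online_sinkhorn_step:
  assumes t: "t > 0" and \<eta>: "0 \<le> \<eta> t" "\<eta> t \<le> 1"
  shows "exp (- sinkhorn_f C \<eta> b x y (t + 1) z) =
           (1 - \<eta> t) * exp (- sinkhorn_f C \<eta> b x y t z)
             + \<eta> t * exp (- soft_C_transform C (empirical b y t) (sinkhorn_g C \<eta> b x y t) z)"
    and "exp (- sinkhorn_g C \<eta> b x y (t + 1) z) =
           (1 - \<eta> t) * exp (- sinkhorn_g C \<eta> b x y t z)
             + \<eta> t * exp (- soft_C_transform C (empirical b x t) (sinkhorn_f C \<eta> b x y t) z)"
proof -
  obtain k where "t = Suc k" using t by (cases t) auto
  then show "exp (- sinkhorn_f C \<eta> b x y (t + 1) z) =
           (1 - \<eta> t) * exp (- sinkhorn_f C \<eta> b x y t z)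
             + \<eta> t * exp (- soft_C_transform C (empirical b y t) (sinkhorn_g C \<eta> b x y t) z)"
    and "exp (- sinkhorn_g C \<eta> b x y (t + 1) z) =
           (1 - \<eta> t) * exp (- sinkhorn_g C \<eta> b x y t z)
             + \<eta> t * exp (- soft_C_transform C (empirical b x t) (sinkhorn_f C \<eta> b x y t) z)"
    using convex_exp_pos[OF \<eta>] by (simp_all add: case_prod_beta Let_def)
qed

end

theory Submission
  imports Defs
begin

text \<open>
  Put \<open>p\<^sub>t = exp (f\<^sup>\<star> - f\<^sub>t)\<close>, \<open>q\<^sub>t = exp (g\<^sup>\<star> - g\<^sub>t)\<close> and
  \<open>k x y = exp (f\<^sup>\<star> x + g\<^sup>\<star> y - C x y)\<close>. The fixed-point equations for the optimal potentials say
  that \<open>k\<close> has integral 1 in each variable, and the algorithm becomes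
  \<open>p\<^bsub>t+1\<^esub> = (1 - \<eta>\<^sub>t) p\<^sub>t + \<eta>\<^sub>t \<cdot> (batch mean of k x y / q\<^sub>t y over y)\<close>, together with the mirror
  image of this for \<open>q\<close>. For a fixed \<open>q\<close>, the batch mean is an unbiased estimate of an integral against \<open>\<beta>\<close>, and
  the weights \<open>\<eta>\<^sub>t\<close> are square summable, so the sampling noise averages out over time even though the
  batch size is constant. Hence the iterates follow the noiseless flow, which contracts towards
  constant functions \<open>p\<close> and \<open>q\<close>. Both variation norms therefore tend to 0 almost surely, and
  the bound holds with a constant that depends on nothing.

  Only \<open>X\<close> and \<open>Y\<close> separately are assumed to be independent sequences; their joint law is
  arbitrary. So \<open>g\<^sub>t\<close>, which involves past values of \<open>Y\<close> and of \<open>X\<close>, may well depend on the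
  batch of \<open>Y\<close> with which it is about to be averaged, and the noise need not be a martingale difference.
  Instead, time is cut into windows in which \<open>\<Sum> \<eta>\<close> is about \<open>\<tau>\<close>. Inside a window the
  iterates are frozen up to a relative error \<open>O(\<tau>)\<close>, and what remains is a law of large
  numbers along windows, uniform over a compact class of test functions
  (\<open>AE_equidistributed\<close>). It follows from second moments of the frequencies of finitely many
  Borel sets, because all test functions that occur have a common modulus of continuity.

  For the contraction, the quantity that is controlled is the ratio of the largest to the smallest value
  of \<open>p\<close>, and likewise of \<open>q\<close>. It does not see the neutral direction in which \<open>p\<close> is
  multiplied and \<open>q\<close> divided by the same constant. A positive Markov kernel strictly shrinks this ratio
  (\<open>kernel_contracts_ratio\<close>). One window thus acts as one step that contracts by a factor
  \<open>1 - c \<tau>\<close> and adds an error \<open>o(\<tau>)\<close> (\<open>window_contracts\<close>), where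
  \<open>c > 0\<close> because the products \<open>p\<^sub>t x \<cdot> q\<^sub>t y\<close> stay between two positive
  constants (\<open>product_bounded\<close>). The excess of the ratio over 1 is eventually of the order of
  the error divided by \<open>c \<tau>\<close>, and \<open>\<tau>\<close> is arbitrary.

  The second half of the statement, in which the constant may depend on the batch size, needs no
  probability: all iterates inherit the modulus of continuity of the cost, so their variation norms are
  bounded.
\<close>

section \<open>Log-Lipschitz functions\<close>

text \<open>Exponentials of Lipschitz functions, described multiplicatively. In this form the class is visibly
closed under positive combinations and integrals, which is how the iterates arise; for
\<open>exp (- f\<^sub>t)\<close> the constant stays that of the cost for all times.\<close>

definition log_lipschitz :: "real \<Rightarrow> ('a::metric_space \<Rightarrow> real) \<Rightarrow> bool" where
  "log_lipschitz K \<phi> \<longleftrightarrow> (\<forall>x. 0 < \<phi> x) \<and> (\<forall>x y. \<phi> x \<le> exp (K * dist x y) * \<phi> y)"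

lemma log_lipschitzI:
  assumes "\<And>x. 0 < \<phi> x" "\<And>x y. \<phi> x \<le> exp (K * dist x y) * \<phi> y"
  shows "log_lipschitz K \<phi>"
  using assms by (auto simp: log_lipschitz_def)

lemma log_lipschitz_pos: "log_lipschitz K \<phi> \<Longrightarrow> 0 < \<phi> x"
  by (simp add: log_lipschitz_def)

lemma log_lipschitzD: "log_lipschitz K \<phi> \<Longrightarrow> \<phi> x \<le> exp (K * dist x y) * \<phi> y"
  by (simp add: log_lipschitz_def)

lemma log_lipschitz_le:
  assumes "log_lipschitz K \<phi>" "0 \<le> K" "dist x y \<le> d"
  shows "\<phi> x \<le> exp (K * d) * \<phi> y"
proof -
  have "exp (K * dist x y) * \<phi> y \<le> exp (K * d) * \<phi> y"
    using assms log_lipschitz_pos[OF assms(1), of y] by (intro mult_right_mono) (auto intro: mult_left_mono)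
  with log_lipschitzD[OF assms(1), of x y] show ?thesis by linarith
qed

lemma log_lipschitz_exp:
  assumes "K-lipschitz_on UNIV h"
  shows "log_lipschitz K (\<lambda>x. exp (h x))"
proof (rule log_lipschitzI)
  fix x y
  have "h x - h y \<le> K * dist x y"
    using lipschitz_onD[OF assms, of x y] by (auto simp: dist_real_def)
  then show "exp (h x) \<le> exp (K * dist x y) * exp (h y)"
    by (simp flip: exp_add)
qed simp

lemma log_lipschitz_ln:
  assumes "log_lipschitz K \<phi>" "0 \<le> K"
  shows "K-lipschitz_on UNIV (\<lambda>x. ln (\<phi> x))"
proof (rule lipschitz_onI[OF _ assms(2)])
  have *: "ln (\<phi> x) - ln (\<phi> y) \<le> K * dist x y" for x y
  proof -
    have "ln (\<phi> x) \<le> ln (exp (K * dist x y) * \<phi> y)"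
      using log_lipschitz_pos[OF assms(1)] by (subst ln_le_cancel_iff) (auto intro: log_lipschitzD[OF assms(1)])
    also have "\<dots> = K * dist x y + ln (\<phi> y)"
      using log_lipschitz_pos[OF assms(1), of y] by (simp add: ln_mult)
    finally show ?thesis by simp
  qed
  show "dist (ln (\<phi> x)) (ln (\<phi> y)) \<le> K * dist x y" for x y
    using *[of x y] *[of y x] by (auto simp: dist_real_def dist_commute abs_le_iff)
qed

lemma log_lipschitz_continuous:
  assumes "log_lipschitz K \<phi>" "0 \<le> K"
  shows "continuous_on UNIV \<phi>"
proof -
  have "continuous_on UNIV (\<lambda>x. exp (ln (\<phi> x)))"
    by (intro continuous_intros lipschitz_on_continuous_on[OF log_lipschitz_ln[OF assms]])
  then show ?thesis
    using log_lipschitz_pos[OF assms(1)] by simp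
qed

lemma log_lipschitz_mult:
  assumes "log_lipschitz K \<phi>" "log_lipschitz J \<psi>"
  shows "log_lipschitz (K + J) (\<lambda>x. \<phi> x * \<psi> x)"
proof (rule log_lipschitzI)
  show "0 < \<phi> x * \<psi> x" for x using assms by (simp add: log_lipschitz_pos)
  show "\<phi> x * \<psi> x \<le> exp ((K + J) * dist x y) * (\<phi> y * \<psi> y)" for x y
    using mult_mono[OF log_lipschitzD[OF assms(1), of x y] log_lipschitzD[OF assms(2), of x y]]
      log_lipschitz_pos[OF assms(1)] log_lipschitz_pos[OF assms(2)]
    by (simp add: exp_add ring_distribs mult_ac less_imp_le)
qed

lemma log_lipschitz_inverse:
  assumes "log_lipschitz K \<phi>"
  shows "log_lipschitz K (\<lambda>x. 1 / \<phi> x)"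
proof (rule log_lipschitzI)
  show "0 < 1 / \<phi> x" for x using assms by (simp add: log_lipschitz_pos)
  show "1 / \<phi> x \<le> exp (K * dist x y) * (1 / \<phi> y)" for x y
    using log_lipschitzD[OF assms, of y x] log_lipschitz_pos[OF assms]
    by (simp add: field_simps dist_commute)
qed

lemma log_lipschitz_scale:
  assumes "log_lipschitz K \<phi>" "0 < c"
  shows "log_lipschitz K (\<lambda>x. c * \<phi> x)"
  using assms by (auto simp: log_lipschitz_def mult_left_mono mult.left_commute)

lemma log_lipschitz_sum:
  assumes "finite I" "I \<noteq> {}" "\<And>i. i \<in> I \<Longrightarrow> log_lipschitz K (\<phi> i)"
  shows "log_lipschitz K (\<lambda>x. \<Sum>i\<in>I. \<phi> i x)"
proof (rule log_lipschitzI)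
  show "0 < (\<Sum>i\<in>I. \<phi> i x)" for x
    using assms by (intro sum_pos) (auto intro: log_lipschitz_pos)
  show "(\<Sum>i\<in>I. \<phi> i x) \<le> exp (K * dist x y) * (\<Sum>i\<in>I. \<phi> i y)" for x y
    unfolding sum_distrib_left by (intro sum_mono log_lipschitzD assms)
qed

lemma log_lipschitz_convex:
  assumes "log_lipschitz K \<phi>" "log_lipschitz K \<psi>" "0 \<le> e" "e \<le> 1"
  shows "log_lipschitz K (\<lambda>x. (1 - e) * \<phi> x + e * \<psi> x)"
proof (rule log_lipschitzI)
  show "0 < (1 - e) * \<phi> x + e * \<psi> x" for x
    using convex_exp_pos[OF assms(3,4), of "ln (\<phi> x)" "ln (\<psi> x)"] assms by (simp add: log_lipschitz_pos)
  show "(1 - e) * \<phi> x + e * \<psi> x \<le> exp (K * dist x y) * ((1 - e) * \<phi> y + e * \<psi> y)" for x y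
    using add_mono[OF mult_left_mono[OF log_lipschitzD[OF assms(1), of x y], of "1 - e"]
      mult_left_mono[OF log_lipschitzD[OF assms(2), of x y] assms(3)]] assms(4)
    by (simp add: algebra_simps)
qed

section \<open>Windows of a step-size sequence\<close>

text \<open>The sum of the step sizes before \<open>t\<close> serves as a clock, and the window \<open>k\<close> of length
\<open>\<tau>\<close> consists of the times at which the clock reads between \<open>k \<tau>\<close> and
\<open>(k + 1) \<tau>\<close>.\<close>

locale step_sizes =
  fixes \<eta> :: "nat \<Rightarrow> real"
  assumes \<eta>_nonneg: "t > 0 \<Longrightarrow> 0 \<le> \<eta> t"
    and \<eta>_le_1: "t > 0 \<Longrightarrow> \<eta> t \<le> 1"
    and \<eta>_diverges: "filterlim (\<lambda>T. \<Sum>t = 1..T. \<eta> t) at_top sequentially"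
    and \<eta>_square_summable: "summable (\<lambda>t. (\<eta> t)\<^sup>2)"
begin

definition clock :: "nat \<Rightarrow> real" where
  "clock t = (\<Sum>s = 1..<t. \<eta> s)"

definition win :: "real \<Rightarrow> nat \<Rightarrow> nat" where
  "win \<tau> k = (LEAST t. real k * \<tau> \<le> clock t)"

abbreviation "window \<tau> k \<equiv> {win \<tau> k..<win \<tau> (Suc k)}"

lemma clock_Suc: "0 < t \<Longrightarrow> clock (Suc t) = clock t + \<eta> t"
  by (simp add: clock_def)

lemma clock_mono: "s \<le> t \<Longrightarrow> clock s \<le> clock t"
  unfolding clock_def by (intro sum_mono2) (auto intro: \<eta>_nonneg)

lemma clock_diff:
  assumes "0 < s" "s \<le> t"
  shows "clock t - clock s = (\<Sum>r = s..<t. \<eta> r)"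
proof -
  have "{1..<t} = {1..<s} \<union> {s..<t}" using assms by auto
  then show ?thesis unfolding clock_def
    by (simp add: sum.union_disjoint ivl_disj_int)
qed

lemma clock_unbounded: "\<exists>t. c \<le> clock t"
proof -
  obtain T where "c \<le> (\<Sum>t = 1..T. \<eta> t)"
    using \<eta>_diverges by (force simp: filterlim_at_top eventually_sequentially)
  moreover have "{1..T} = {1..<Suc T}" by auto
  ultimately show ?thesis unfolding clock_def by metis
qed

lemma \<eta>_tendsto_0: "\<eta> \<longlonglongrightarrow> 0"
  using summable_LIMSEQ_zero[OF \<eta>_square_summable] by (simp add: tendsto_power_zero flip: power2_eq_square) 

lemma win_le_clock: "real k * \<tau> \<le> clock (win \<tau> k)"
  unfolding win_def using clock_unbounded by (rule LeastI_ex)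

lemma clock_less_win: "t < win \<tau> k \<Longrightarrow> clock t < real k * \<tau>"
  unfolding win_def using not_less_Least by fastforce

lemma win_least: "real k * \<tau> \<le> clock t \<Longrightarrow> win \<tau> k \<le> t"
  unfolding win_def by (rule Least_le)

lemma win_0 [simp]: "win \<tau> 0 = 0"
  unfolding win_def by (rule Least_eq_0) (simp add: clock_def)

lemma win_mono: "0 < \<tau> \<Longrightarrow> k \<le> l \<Longrightarrow> win \<tau> k \<le> win \<tau> l"
  by (rule win_least, rule order_trans[OF _ win_le_clock]) (simp add: mult_right_mono)

lemma eventually_win_ge:
  assumes "0 < \<tau>"
  shows "\<forall>\<^sub>F k in sequentially. N \<le> win \<tau> k"
proof -
  obtain k0 :: nat where k0: "clock N < real k0 * \<tau>"
    using assms reals_Archimedean3 by blast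
  have "N \<le> win \<tau> k" if "k0 \<le> k" for k
  proof (rule ccontr)
    assume "\<not> N \<le> win \<tau> k"
    then have "clock (win \<tau> k) \<le> clock N" by (intro clock_mono) simp
    moreover have "real k0 * \<tau> \<le> real k * \<tau>" using that assms by (simp add: mult_right_mono)
    ultimately show False using win_le_clock[of k \<tau>] k0 by linarith
  qed
  then show ?thesis by (auto simp: eventually_sequentially)
qed

text \<open>The clock jumps past \<open>k \<tau>\<close> by at most one step, and steps tend to 0.\<close>

lemma eventually_clock_win:
  assumes "0 < \<tau>"
  shows "\<forall>\<^sub>F k in sequentially. clock (win \<tau> k) \<le> real k * \<tau> + \<tau> / 2"
proof -
  have "\<forall>\<^sub>F t in sequentially. \<eta> t < \<tau> / 2"
    using assms by (intro order_tendstoD(2)[OF \<eta>_tendsto_0]) simp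
  then obtain N where N: "\<And>t. N \<le> t \<Longrightarrow> \<eta> t < \<tau> / 2" by (auto simp: eventually_sequentially)
  show ?thesis
    using eventually_win_ge[OF assms, of "N + 2"]
  proof eventually_elim
    case (elim k)
    define t where "t = win \<tau> k - 1"
    have t: "win \<tau> k = Suc t" "N \<le> t" "0 < t" using elim by (auto simp: t_def)
    have "clock t < real k * \<tau>" using t by (intro clock_less_win) simp
    with N[of t] t show ?case by (simp add: clock_Suc)
  qed
qed

lemma eventually_window_length:
  assumes "0 < \<tau>"
  shows "\<forall>\<^sub>F k in sequentially. \<tau> / 2 \<le> sum \<eta> (window \<tau> k) \<and> sum \<eta> (window \<tau> k) \<le> 2 * \<tau>"
proof -
  have *: "\<forall>\<^sub>F k in sequentially. clock (win \<tau> (Suc k)) \<le> real (Suc k) * \<tau> + \<tau> / 2"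
    using eventually_clock_win[OF assms] by (subst eventually_sequentially_Suc)
  show ?thesis
    using eventually_clock_win[OF assms] * eventually_win_ge[OF assms, of 1]
  proof eventually_elim
    case (elim k)
    have "sum \<eta> (window \<tau> k) = clock (win \<tau> (Suc k)) - clock (win \<tau> k)"
      using elim win_mono[OF assms, of k "Suc k"] by (simp add: clock_diff)
    then show ?case
      using elim win_le_clock[of k \<tau>] win_le_clock[of "Suc k" \<tau>] assms by (simp add: ring_distribs)
  qed
qed

lemma eventually_in_late_window:
  assumes "0 < \<tau>"
  shows "\<forall>\<^sub>F t in sequentially. \<exists>k\<ge>k0. t \<in> window \<tau> k"
proof -
  have "\<exists>k\<ge>k0. t \<in> window \<tau> k" if "win \<tau> k0 \<le> t" for t
  proof -
    have c0: "0 \<le> clock t" unfolding clock_def by (intro sum_nonneg) (auto intro: \<eta>_nonneg)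
    define k where "k = nat \<lfloor>clock t / \<tau>\<rfloor>"
    have k: "real k * \<tau> \<le> clock t" "clock t < real (Suc k) * \<tau>"
    proof -
      have "real k = real_of_int \<lfloor>clock t / \<tau>\<rfloor>" using c0 assms by (simp add: k_def)
      then have "real k \<le> clock t / \<tau>" "clock t / \<tau> < real (Suc k)" by linarith+
      then show "real k * \<tau> \<le> clock t" "clock t < real (Suc k) * \<tau>"
        using assms by (auto simp: field_simps)
    qed
    have "t < win \<tau> (Suc k)"
    proof (rule ccontr)
      assume "\<not> t < win \<tau> (Suc k)"
      then have "clock (win \<tau> (Suc k)) \<le> clock t" by (intro clock_mono) simp
      then show False using win_le_clock[of "Suc k" \<tau>] k by linarith
    qed
    moreover have "k0 \<le> k"
    proof (rule ccontr)
      assume "\<not> k0 \<le> k"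
      then have "win \<tau> (Suc k) \<le> win \<tau> k0" using assms by (intro win_mono) auto
      with calculation that show False by simp
    qed
    ultimately show ?thesis using win_least[OF k(1)] by auto
  qed
  then show ?thesis by (auto simp: eventually_sequentially)
qed

text \<open>This bounds the sum over all windows of the variances of the noise.\<close>

lemma sum_windows_square:
  assumes "0 < \<tau>"
  shows "(\<Sum>k<N. \<Sum>s\<in>window \<tau> k. (\<eta> s)\<^sup>2) \<le> (\<Sum>s. (\<eta> s)\<^sup>2)"
proof -
  have "(\<Sum>k<N. \<Sum>s\<in>window \<tau> k. (\<eta> s)\<^sup>2) = (\<Sum>s<win \<tau> N. (\<eta> s)\<^sup>2)"
  proof (induction N)
    case (Suc N)
    have "{..<win \<tau> (Suc N)} = {..<win \<tau> N} \<union> window \<tau> N"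
      using win_mono[OF assms, of N "Suc N"] by auto
    then show ?case using Suc by (simp add: sum.union_disjoint ivl_disj_int)
  qed simp
  also have "\<dots> \<le> (\<Sum>s. (\<eta> s)\<^sup>2)"
    by (intro sum_le_suminf \<eta>_square_summable) auto
  finally show ?thesis .
qed

end

section \<open>Batch means and contraction of ratios\<close>

definition batch_mean :: "(nat \<Rightarrow> 'a) \<Rightarrow> nat set \<Rightarrow> ('a \<Rightarrow> real) \<Rightarrow> real" where
  "batch_mean x I \<phi> = (\<Sum>i\<in>I. \<phi> (x i)) / real (card I)"

lemma batch_mean_mono:
  "(\<And>z. \<phi> z \<le> \<psi> z) \<Longrightarrow> batch_mean x I \<phi> \<le> batch_mean x I \<psi>"
  unfolding batch_mean_def by (intro divide_right_mono sum_mono) auto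

lemma batch_mean_cmult: "batch_mean x I (\<lambda>z. c * \<phi> z) = c * batch_mean x I \<phi>"
  by (simp add: batch_mean_def sum_distrib_left)

lemma batch_mean_diff: "batch_mean x I (\<lambda>z. \<phi> z - \<psi> z) = batch_mean x I \<phi> - batch_mean x I \<psi>"
  by (simp add: batch_mean_def sum_subtractf diff_divide_distrib)

lemma batch_mean_const: "finite I \<Longrightarrow> I \<noteq> {} \<Longrightarrow> batch_mean x I (\<lambda>z. c) = c"
  by (simp add: batch_mean_def)

lemma batch_mean_le:
  "finite I \<Longrightarrow> I \<noteq> {} \<Longrightarrow> (\<And>z. \<phi> z \<le> c) \<Longrightarrow> batch_mean x I \<phi> \<le> c"
  using batch_mean_mono[of \<phi> "\<lambda>_. c" x I] by (simp add: batch_mean_const)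

lemma batch_mean_ge:
  "finite I \<Longrightarrow> I \<noteq> {} \<Longrightarrow> (\<And>z. c \<le> \<phi> z) \<Longrightarrow> c \<le> batch_mean x I \<phi>"
  using batch_mean_mono[of "\<lambda>_. c" \<phi> x I] by (simp add: batch_mean_const)

lemma batch_mean_abs_le:
  assumes "\<And>z. \<bar>\<phi> z\<bar> \<le> \<psi> z"
  shows "\<bar>batch_mean x I \<phi>\<bar> \<le> batch_mean x I \<psi>"
proof -
  have "\<bar>\<Sum>i\<in>I. \<phi> (x i)\<bar> \<le> (\<Sum>i\<in>I. \<psi> (x i))"
    by (rule order_trans[OF sum_abs]) (intro sum_mono assms)
  then show ?thesis by (simp add: batch_mean_def abs_divide divide_right_mono)
qed

lemma integrable_continuous_compact:
  fixes \<phi> :: "'a::metric_space \<Rightarrow> real"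
  assumes "compact (UNIV :: 'a set)" "prob_space \<mu>" "sets \<mu> = sets borel" "continuous_on UNIV \<phi>"
  shows "integrable \<mu> \<phi>"
proof -
  interpret prob_space \<mu> by fact
  have "bounded (range \<phi>)"
    by (intro compact_imp_bounded compact_continuous_image assms)
  then obtain B where "\<And>x. norm (\<phi> x) \<le> B" by (auto simp: bounded_iff)
  moreover have "\<phi> \<in> borel_measurable \<mu>"
    using borel_measurable_continuous_onI[OF assms(4)] measurable_cong_sets[OF assms(3) refl] by blast
  ultimately show ?thesis by (intro integrable_const_bound[where B = B]) auto
qed

text \<open>The bound \<open>1 + E\<close> on the quotient of any two values, hence on the exponential of the Hilbert
projective distance from \<open>\<phi>\<close> to the constants. Keeping the excess \<open>E\<close> rather than a
logarithm makes the contraction below linear in \<open>E\<close>.\<close>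

definition ratio_le :: "real \<Rightarrow> ('a \<Rightarrow> real) \<Rightarrow> bool" where
  "ratio_le E \<phi> \<longleftrightarrow> (\<forall>x y. \<phi> x \<le> (1 + E) * \<phi> y)"

lemma ratio_leD: "ratio_le E \<phi> \<Longrightarrow> \<phi> x \<le> (1 + E) * \<phi> y"
  by (simp add: ratio_le_def)

lemma ratio_le_mono: "ratio_le E \<phi> \<Longrightarrow> E \<le> F \<Longrightarrow> (\<And>x. 0 < \<phi> x) \<Longrightarrow> ratio_le F \<phi>"
  unfolding ratio_le_def by (meson add_left_mono less_imp_le mult_right_mono order_trans)

lemma ratio_le_inverse:
  assumes "ratio_le E \<phi>" "\<And>x. 0 < \<phi> x"
  shows "ratio_le E (\<lambda>x. 1 / \<phi> x)"
  using assms by (auto simp: ratio_le_def field_simps)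

text \<open>
  Two rows of the kernel share the mass \<open>\<delta>\<close>, so subtracting the minimum of \<open>r\<close> and
  comparing the rows leaves at most the fraction \<open>1 - \<delta>\<close> of the oscillation of \<open>r\<close>.
  This is an elementary form of Birkhoff's contraction theorem for positive kernels.
\<close>

lemma kernel_contracts_ratio:
  fixes k :: "'a::metric_space \<Rightarrow> 'a \<Rightarrow> real"
  assumes compact: "compact (UNIV :: 'a set)" and \<mu>: "prob_space \<mu>" "sets \<mu> = sets borel"
    and k: "\<And>x. continuous_on UNIV (k x)" "\<And>x. (LINT y|\<mu>. k x y) = 1" "\<And>x y. \<delta> \<le> k x y"
    and \<delta>: "0 \<le> \<delta>"
    and r: "continuous_on UNIV r" "\<And>y. 0 < r y" "ratio_le E r"
  shows "ratio_le ((1 - \<delta>) * E) (\<lambda>x. LINT y|\<mu>. k x y * r y)"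
  unfolding ratio_le_def
proof (intro allI)
  fix x x'
  interpret prob_space \<mu> by fact
  note int = integrable_continuous_compact[OF compact \<mu>]
  obtain y0 where y0: "\<And>y. r y0 \<le> r y"
    using continuous_attains_inf[OF compact _ r(1)] by auto
  define lo where "lo = r y0"
  define w where "w = (\<lambda>y. r y - lo)"
  have w: "0 \<le> w y" "w y \<le> E * lo" for y
    using y0[of y] ratio_leD[OF r(3), of y y0] by (auto simp: w_def lo_def ring_distribs)
  have cw: "continuous_on UNIV w" unfolding w_def by (intro continuous_intros r)
  have A: "(LINT y|\<mu>. k z y * r y) = lo + (LINT y|\<mu>. k z y * w y)" for z
  proof -
    have "(LINT y|\<mu>. k z y * r y) = (LINT y|\<mu>. lo * k z y + k z y * w y)"
      by (intro Bochner_Integration.integral_cong) (auto simp: w_def algebra_simps)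
    also have "\<dots> = (LINT y|\<mu>. lo * k z y) + (LINT y|\<mu>. k z y * w y)"
      by (intro Bochner_Integration.integral_add int continuous_intros k cw)
    finally show ?thesis using k(2) by simp
  qed
  have "0 < lo" using r by (simp add: lo_def)
  have "0 \<le> E * lo" using w[of y0] by linarith
  then have E: "0 \<le> E" using \<open>0 < lo\<close> by (simp add: zero_le_mult_iff)
  have "\<delta> \<le> 1"
  proof -
    have "(LINT y|\<mu>. \<delta>) \<le> (LINT y|\<mu>. k x y)"
      by (intro integral_mono int continuous_intros k)
    then show ?thesis using k(2) by (simp add: prob_space)
  qed
  have "(LINT y|\<mu>. k x y * w y) - (LINT y|\<mu>. k x' y * w y) = (LINT y|\<mu>. (k x y - k x' y) * w y)"
    by (subst Bochner_Integration.integral_diff[symmetric]) (auto intro!: int continuous_intros k cw simp: left_diff_distrib)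
  also have "\<dots> \<le> (LINT y|\<mu>. (k x y - \<delta>) * (E * lo))"
  proof (intro integral_mono int continuous_intros k cw)
    fix y
    have "(k x y - k x' y) * w y \<le> (k x y - \<delta>) * w y"
      using k(3)[of x' y] w by (intro mult_right_mono) auto
    also have "\<dots> \<le> (k x y - \<delta>) * (E * lo)"
      using k(3)[of x y] w by (intro mult_left_mono) auto
    finally show "(k x y - k x' y) * w y \<le> (k x y - \<delta>) * (E * lo)" .
  qed
  also have "\<dots> = (1 - \<delta>) * E * lo"
  proof -
    have "integrable \<mu> (k x)" by (intro int k)
    then have "(LINT y|\<mu>. k x y - \<delta>) = 1 - \<delta>"
      using k(2) by (simp add: prob_space)
    then show ?thesis by simp
  qed
  also have "\<dots> \<le> (1 - \<delta>) * E * (LINT y|\<mu>. k x' y * r y)"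
  proof (intro mult_left_mono)
    have "0 \<le> (LINT y|\<mu>. k x' y * w y)"
      using w k(3) \<delta> by (intro Bochner_Integration.integral_nonneg mult_nonneg_nonneg) (auto intro: order_trans)
    then show "lo \<le> (LINT y|\<mu>. k x' y * r y)" using A[of x'] by simp
  qed (use \<open>\<delta> \<le> 1\<close> E in auto)
  finally show "(LINT y|\<mu>. k x y * r y) \<le> (1 + (1 - \<delta>) * E) * (LINT y|\<mu>. k x' y * r y)"
    using A[of x] A[of x'] by (simp add: ring_distribs)
qed

text \<open>
  The effect of one step \<open>(1 - h) p + h A\<close> on the ratio of two values of \<open>p\<close>, when the
  corresponding ratio for \<open>A\<close> is already smaller by \<open>1 - \<delta>\<close>. The new ratio is a mean of
  the two, in which \<open>A\<close> has a weight of at least \<open>c h\<close> because \<open>A \<ge> c p\<close>. The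
  perturbation, of relative size \<open>h e\<close>, costs an amount proportional to \<open>h e\<close>; here
  \<open>F\<close> is an a priori bound on the new excess.
\<close>

lemma perturbed_step_ratio:
  fixes p1 p2 A1 A2 h e E \<delta> c :: real
  assumes pos: "0 < p2" "0 < A2" "0 \<le> p1"
    and p: "p1 \<le> (1 + E) * p2" "p1 \<le> \<Lambda> * p2" and A: "A1 \<le> (1 + (1 - \<delta>) * E) * A2" "c * p2 \<le> A2"
    and const: "0 \<le> \<delta>" "0 < c" "c \<le> 1" "0 \<le> h" "h \<le> 1/2" "0 \<le> e" "1 \<le> \<Lambda>" "0 \<le> E"
    and u1: "u1 \<le> (1 - h) * p1 + h * A1 + h * e * p1"
    and u2: "(1 - h) * p2 + h * A2 - h * e * p2 \<le> u2"
    and E': "E - \<delta> * c * h * E + 2 * (1 + F + \<Lambda>) * h * e \<le> E'" "E' \<le> F" "0 \<le> E'"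
  shows "u1 \<le> (1 + E') * u2"
proof -
  define N where "N = (1 - h) * p2 + h * A2"
  \<comment> \<open>\<open>N\<close> is the unperturbed value at the second point; it absorbs both \<open>A2\<close> and \<open>p2\<close>.\<close>
  have N: "c * N \<le> A2" "p2 \<le> 2 * N" "0 \<le> N"
  proof -
    have "c * ((1 - h) * p2) \<le> (1 - h) * A2"
      using mult_left_mono[OF A(2), of "1 - h"] const by (simp add: mult_ac)
    moreover have "c * (h * A2) \<le> h * A2"
      using const pos by (intro mult_left_le_one_le) auto
    ultimately show "c * N \<le> A2" unfolding N_def by (simp add: ring_distribs)
    have "h * p2 \<le> 1/2 * p2" using const pos by (intro mult_right_mono) auto
    moreover have "0 \<le> h * A2" using const pos by simp
    ultimately show "p2 \<le> 2 * N" unfolding N_def by (simp add: algebra_simps)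
    show "0 \<le> N" using const pos unfolding N_def by simp
  qed
  have "u1 \<le> (1 - h) * ((1 + E) * p2) + h * ((1 + (1 - \<delta>) * E) * A2) + h * e * (\<Lambda> * p2)"
    using const p A by (intro order_trans[OF u1] add_mono mult_left_mono) auto
  also have "\<dots> = (1 + E) * N - \<delta> * h * E * A2 + h * e * \<Lambda> * p2"
    by (simp add: N_def algebra_simps)
  also have "\<dots> \<le> (1 + E) * N - \<delta> * h * E * (c * N) + h * e * \<Lambda> * p2"
    using mult_left_mono[OF N(1), of "\<delta> * h * E"] const by simp
  also have "\<dots> \<le> (1 + E') * N - (1 + E') * (h * e * p2)"
  proof -
    have "(E - \<delta> * c * h * E + 2 * (1 + F + \<Lambda>) * h * e) * N \<le> E' * N"
      using E' N by (intro mult_right_mono)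
    moreover have "h * e * (1 + E' + \<Lambda>) * p2 \<le> h * e * (1 + F + \<Lambda>) * (2 * N)"
      using const E' N pos by (intro mult_mono mult_left_mono) auto
    ultimately show ?thesis by (simp add: algebra_simps)
  qed
  also have "\<dots> = (1 + E') * (N - h * e * p2)" by (simp add: algebra_simps)
  also have "\<dots> \<le> (1 + E') * u2"
    using u2 E' by (intro mult_left_mono) (auto simp: N_def)
  finally show ?thesis .
qed

context step_sizes begin

text \<open>
  The noise accumulated over a late window is small, uniformly over the class of test functions. The
  uniformity allows test functions that themselves depend on the samples. The window lengths
  \<open>1 / Suc j\<close> are countably many, so that the property can hold for all of them almost surely.
\<close>

definition equidistributed where
  "equidistributed K I x \<mu> \<longleftrightarrow> (\<forall>j::nat. \<forall>\<epsilon>>0. \<forall>\<^sub>F k in sequentially.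
      \<forall>\<phi>. log_lipschitz K \<phi> \<longrightarrow> (\<forall>z. \<phi> z \<le> 1) \<longrightarrow>
        \<bar>\<Sum>s\<in>window (1 / Suc j) k. \<eta> s * (batch_mean x (I s) \<phi> - (LINT z|\<mu>. \<phi> z))\<bar> \<le> \<epsilon>)"

end

section \<open>The averaged dynamics\<close>

text \<open>
  The dynamics of the normalised iterates, for one fixed realisation of the samples. The factor 2 in the
  last two assumptions is due to test functions of the form \<open>k x \<cdot> (1 / q)\<close>, in which two
  log-Lipschitz constants add up. The locale is symmetric under exchange of \<open>p\<close> and \<open>q\<close>,
  so one-sided facts are proved for \<open>p\<close> and transferred to \<open>q\<close> by \<open>swap\<close>.
\<close>

locale sinkhorn_dynamics = step_sizes \<eta> for \<eta> +
  fixes k :: "'a::metric_space \<Rightarrow> 'a \<Rightarrow> real" and K :: real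
    and \<alpha> \<beta> :: "'a measure" and I :: "nat \<Rightarrow> nat set" and xs ys :: "nat \<Rightarrow> 'a"
    and p q :: "nat \<Rightarrow> 'a \<Rightarrow> real"
  assumes compact: "compact (UNIV :: 'a set)" and K_nonneg: "0 \<le> K"
    and \<alpha>: "prob_space \<alpha>" "sets \<alpha> = sets borel"
    and \<beta>: "prob_space \<beta>" "sets \<beta> = sets borel"
    and k_left: "\<And>y. log_lipschitz K (\<lambda>x. k x y)" and k_right: "\<And>x. log_lipschitz K (\<lambda>y. k x y)"
    and k_\<alpha>: "\<And>y. (LINT x|\<alpha>. k x y) = 1" and k_\<beta>: "\<And>x. (LINT y|\<beta>. k x y) = 1"
    and I: "\<And>t. finite (I t)" "\<And>t. I t \<noteq> {}"
    and p_1: "log_lipschitz K (p 1)" and q_1: "log_lipschitz K (q 1)"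
    and p_step: "\<And>t x. 0 < t \<Longrightarrow>
      p (Suc t) x = (1 - \<eta> t) * p t x + \<eta> t * batch_mean ys (I t) (\<lambda>y. k x y / q t y)"
    and q_step: "\<And>t y. 0 < t \<Longrightarrow>
      q (Suc t) y = (1 - \<eta> t) * q t y + \<eta> t * batch_mean xs (I t) (\<lambda>x. k x y / p t x)"
    and equi_x: "equidistributed (2 * K) I xs \<alpha>" and equi_y: "equidistributed (2 * K) I ys \<beta>"
begin

lemma swap: "sinkhorn_dynamics \<eta> (\<lambda>x y. k y x) K \<beta> \<alpha> I ys xs q p"
  by (intro sinkhorn_dynamics.intro sinkhorn_dynamics_axioms.intro)
    (assumption | rule step_sizes_axioms compact K_nonneg \<alpha> \<beta> k_left k_right k_\<alpha> k_\<beta> I p_1 q_1 p_step q_step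
      equi_x equi_y)+

text \<open>Bounds the quotient of any two values of any function of the class.\<close>

definition \<Lambda> :: real where "\<Lambda> = exp (K * diameter (UNIV :: 'a set))"

lemma \<Lambda>_ge_1: "1 \<le> \<Lambda>"
  unfolding \<Lambda>_def using diameter_ge_0[OF compact_imp_bounded[OF compact]] K_nonneg by simp

lemma log_lipschitz_le_\<Lambda>: "log_lipschitz K \<phi> \<Longrightarrow> \<phi> x \<le> \<Lambda> * \<phi> (y::'a)"
  unfolding \<Lambda>_def using K_nonneg compact_imp_bounded[OF compact]
  by (intro log_lipschitz_le) (auto intro: diameter_bounded_bound)

lemma log_lipschitz_pq: "0 < t \<Longrightarrow> log_lipschitz K (p t) \<and> log_lipschitz K (q t)"
proof (induction t)
  case (Suc t)
  show ?case
  proof (cases "t = 0")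
    case True
    then show ?thesis using p_1 q_1 by simp
  next
    case False
    then have t: "0 < t" by simp
    note IH = Suc.IH[OF t]
    have c: "0 < real (card (I t))" using I by (simp add: card_gt_0_iff)
    have "log_lipschitz K (\<lambda>x. batch_mean ys (I t) (\<lambda>y. k x y / q t y))"
    proof -
      have "log_lipschitz K (\<lambda>x. \<Sum>i\<in>I t. (1 / q t (ys i) / card (I t)) * k x (ys i))"
        using I log_lipschitz_pos[OF conjunct2[OF IH]] c by (intro log_lipschitz_sum log_lipschitz_scale k_left) auto
      then show ?thesis by (simp add: batch_mean_def sum_divide_distrib)
    qed
    moreover have "log_lipschitz K (\<lambda>y. batch_mean xs (I t) (\<lambda>x. k x y / p t x))"
    proof -
      have "log_lipschitz K (\<lambda>y. \<Sum>i\<in>I t. (1 / p t (xs i) / card (I t)) * k (xs i) y)"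
        using I log_lipschitz_pos[OF conjunct1[OF IH]] c by (intro log_lipschitz_sum log_lipschitz_scale k_right) auto
      then show ?thesis by (simp add: batch_mean_def sum_divide_distrib)
    qed
    ultimately have "log_lipschitz K (\<lambda>x. (1 - \<eta> t) * p t x + \<eta> t * batch_mean ys (I t) (\<lambda>y. k x y / q t y))"
      "log_lipschitz K (\<lambda>y. (1 - \<eta> t) * q t y + \<eta> t * batch_mean xs (I t) (\<lambda>x. k x y / p t x))"
      using IH by (intro log_lipschitz_convex \<eta>_nonneg \<eta>_le_1 t; simp)+
    moreover have "p (Suc t) = (\<lambda>x. (1 - \<eta> t) * p t x + \<eta> t * batch_mean ys (I t) (\<lambda>y. k x y / q t y))"
      "q (Suc t) = (\<lambda>y. (1 - \<eta> t) * q t y + \<eta> t * batch_mean xs (I t) (\<lambda>x. k x y / p t x))"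
      using p_step[OF t] q_step[OF t] by auto
    ultimately show ?thesis by metis
  qed
qed simp

lemma log_lipschitz_p: "0 < t \<Longrightarrow> log_lipschitz K (p t)"
  and log_lipschitz_q: "0 < t \<Longrightarrow> log_lipschitz K (q t)"
  using log_lipschitz_pq by auto

lemma p_pos: "0 < t \<Longrightarrow> 0 < p t x" and q_pos: "0 < t \<Longrightarrow> 0 < q t x"
  using log_lipschitz_pos log_lipschitz_pq by blast+

lemma k_continuous: "continuous_on UNIV (k x)"
  using log_lipschitz_continuous[OF k_right K_nonneg] .

lemma integrable_\<beta>: "continuous_on UNIV \<phi> \<Longrightarrow> integrable \<beta> (\<phi> :: 'a \<Rightarrow> real)"
  by (rule integrable_continuous_compact[OF compact \<beta>])

text \<open>A function with mean 1 whose values differ by at most the factor \<open>\<Lambda>\<close> lies between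
\<open>1 / \<Lambda>\<close> and \<open>\<Lambda>\<close>.\<close>

lemma k_bounds: "1 / \<Lambda> \<le> k x y" "k x y \<le> \<Lambda>"
proof -
  interpret \<beta>: prob_space \<beta> by (rule \<beta>)
  have "(LINT y'|\<beta>. k x y') \<le> (LINT y'|\<beta>. \<Lambda> * k x y)"
    by (intro integral_mono integrable_\<beta> k_continuous continuous_intros log_lipschitz_le_\<Lambda> k_right)
  then have "1 \<le> \<Lambda> * k x y" by (simp add: k_\<beta> \<beta>.prob_space)
  then show "1 / \<Lambda> \<le> k x y" using \<Lambda>_ge_1 by (simp add: field_simps)
  have "(LINT y'|\<beta>. k x y) \<le> (LINT y'|\<beta>. \<Lambda> * k x y')"
    by (intro integral_mono integrable_\<beta> k_continuous continuous_intros log_lipschitz_le_\<Lambda> k_right)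
  then show "k x y \<le> \<Lambda>" by (simp add: k_\<beta> \<beta>.prob_space)
qed

lemma k_div_q_bounds:
  assumes "0 < t"
  shows "1 / \<Lambda>\<^sup>2 \<le> k x y / q t y * q t y'" "k x y / q t y * q t y' \<le> \<Lambda>\<^sup>2"
proof -
  note q = log_lipschitz_le_\<Lambda>[OF log_lipschitz_q[OF assms]]
  have L: "0 < \<Lambda>" using \<Lambda>_ge_1 by simp
  have r: "1 / \<Lambda> \<le> q t y' / q t y" "q t y' / q t y \<le> \<Lambda>"
    using q[of y y'] q[of y' y] L q_pos[OF assms, of y] by (simp_all add: field_simps)
  have "1 / \<Lambda> * (1 / \<Lambda>) \<le> k x y * (q t y' / q t y)"
    using k_bounds(1) r(1) L log_lipschitz_pos[OF k_right, of x y] by (intro mult_mono) auto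
  moreover have "k x y * (q t y' / q t y) \<le> \<Lambda> * \<Lambda>"
    using k_bounds(2) r(2) L q_pos[OF assms] by (intro mult_mono) (auto intro: less_imp_le)
  ultimately show "1 / \<Lambda>\<^sup>2 \<le> k x y / q t y * q t y'" "k x y / q t y * q t y' \<le> \<Lambda>\<^sup>2"
    by (simp_all add: power2_eq_square)
qed

lemma batch_mean_bounds:
  assumes "0 < t"
  shows "1 / \<Lambda>\<^sup>2 \<le> batch_mean ys (I s) (\<lambda>y. k x y / q t y) * q t y'"
    and "batch_mean ys (I s) (\<lambda>y. k x y / q t y) * q t y' \<le> \<Lambda>\<^sup>2"
proof -
  have *: "batch_mean ys (I s) (\<lambda>y. k x y / q t y) * q t y' = batch_mean ys (I s) (\<lambda>y. k x y / q t y * q t y')"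
    using batch_mean_cmult[of ys "I s" "q t y'" "\<lambda>y. k x y / q t y"] by (simp add: mult_ac)
  show "1 / \<Lambda>\<^sup>2 \<le> batch_mean ys (I s) (\<lambda>y. k x y / q t y) * q t y'"
    "batch_mean ys (I s) (\<lambda>y. k x y / q t y) * q t y' \<le> \<Lambda>\<^sup>2"
    unfolding * by (intro batch_mean_ge batch_mean_le I k_div_q_bounds[OF assms])+
qed

lemma \<eta>_eventually_small: "\<exists>t0>0. \<forall>t\<ge>t0. \<eta> t \<le> 1/2"
proof -
  have "\<forall>\<^sub>F t in sequentially. \<eta> t < 1/2"
    by (rule order_tendstoD(2)[OF \<eta>_tendsto_0]) simp
  then obtain N where "\<And>t. N \<le> t \<Longrightarrow> \<eta> t < 1/2" by (auto simp: eventually_sequentially)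
  then show ?thesis by (intro exI[of _ "Suc N"]) (auto simp: less_imp_le)
qed

text \<open>
  The product of \<open>p\<close> with \<open>q\<close> is invariant under the neutral scaling
  \<open>(p, q) \<mapsto> (c p, q / c)\<close>, and it is mean-reverting. In the product of the two updates, the
  mixed terms \<open>A Q\<close> and \<open>B P\<close> lie between \<open>1 / \<Lambda>\<^sup>2\<close> and \<open>\<Lambda>\<^sup>2\<close>
  whatever the current state is. For the lower bound they outweigh the loss
  \<open>1 - (1 - \<eta>)\<^sup>2\<close> as soon as \<open>\<eta> \<le> 1/2\<close>, since \<open>\<rho>\<close> is at most half their
  smallest value. For the upper bound the remaining term \<open>A B\<close> is controlled by the lower bound,
  because \<open>A B \<cdot> P Q \<le> \<Lambda>\<^sup>4\<close>.
\<close>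

lemma product_bounded:
  "\<exists>t0>0. \<exists>R\<ge>2. \<forall>t\<ge>t0. \<eta> t \<le> 1/2 \<and> (\<forall>x y. 1 / R \<le> p t x * q t y \<and> p t x * q t y \<le> R)"
proof -
  obtain t0 where t0: "0 < t0" "\<And>t. t0 \<le> t \<Longrightarrow> \<eta> t \<le> 1/2" using \<eta>_eventually_small by blast
  define z :: 'a where "z = undefined"
  define w where "w = p t0 z * q t0 z"
  have w_pos: "0 < w" using t0 by (simp add: w_def p_pos q_pos)
  have L: "0 < \<Lambda>" using \<Lambda>_ge_1 by simp
  have w: "w / \<Lambda>\<^sup>2 \<le> p t0 x * q t0 y" "p t0 x * q t0 y \<le> \<Lambda>\<^sup>2 * w" for x y
  proof -
    note lp = log_lipschitz_le_\<Lambda>[OF log_lipschitz_p[OF t0(1)]]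
    note lq = log_lipschitz_le_\<Lambda>[OF log_lipschitz_q[OF t0(1)]]
    have "w \<le> (\<Lambda> * p t0 x) * (\<Lambda> * q t0 y)" unfolding w_def
      using t0 L by (intro mult_mono lp lq) (auto simp: p_pos q_pos less_imp_le)
    then show "w / \<Lambda>\<^sup>2 \<le> p t0 x * q t0 y" using L by (simp add: field_simps power2_eq_square)
    have "p t0 x * q t0 y \<le> (\<Lambda> * p t0 z) * (\<Lambda> * q t0 z)"
      using t0 L by (intro mult_mono lp lq) (auto simp: p_pos q_pos less_imp_le)
    then show "p t0 x * q t0 y \<le> \<Lambda>\<^sup>2 * w" unfolding w_def by (simp add: power2_eq_square mult_ac)
  qed
  define \<rho> where "\<rho> = min (w / \<Lambda>\<^sup>2) (1 / (2 * \<Lambda>\<^sup>2))"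
  have \<rho>: "0 < \<rho>" "\<rho> \<le> w / \<Lambda>\<^sup>2" "2 * \<rho> \<le> 1 / \<Lambda>\<^sup>2" using w_pos L by (auto simp: \<rho>_def min_def)
  define U where "U = max (\<Lambda>\<^sup>2 * w) (max (\<Lambda>\<^sup>2) (\<Lambda>\<^sup>2 * \<Lambda>\<^sup>2 / \<rho>))"
  have U: "\<Lambda>\<^sup>2 * w \<le> U" "\<Lambda>\<^sup>2 \<le> U" "\<Lambda>\<^sup>2 * \<Lambda>\<^sup>2 / \<rho> \<le> U" by (auto simp: U_def)
  have main: "\<forall>x y. \<rho> \<le> p t x * q t y \<and> p t x * q t y \<le> U" if "t0 \<le> t" for t
    using that
  proof (induction t rule: dec_induct)
    case base
    show ?case by (intro allI conjI order_trans[OF \<rho>(2) w(1)] order_trans[OF w(2) U(1)])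
  next
    case (step t)
    interpret sw: sinkhorn_dynamics \<eta> "\<lambda>x y. k y x" K \<beta> \<alpha> I ys xs q p by (rule swap)
    have t: "0 < t" "\<eta> t \<le> 1/2" "0 \<le> \<eta> t" using step t0 \<eta>_nonneg by auto
    show ?case
    proof (intro allI)
      fix x y
      define e where "e = \<eta> t"
      define P where "P = p t x" define Q where "Q = q t y"
      define A where "A = batch_mean ys (I t) (\<lambda>y. k x y / q t y)"
      define B where "B = batch_mean xs (I t) (\<lambda>x. k x y / p t x)"
      have e: "0 \<le> e" "e \<le> 1/2" using t by (auto simp: e_def)
      have PQ: "\<rho> \<le> P * Q" "P * Q \<le> U" using step.IH by (auto simp: P_def Q_def)
      have AQ: "1 / \<Lambda>\<^sup>2 \<le> A * Q" "A * Q \<le> \<Lambda>\<^sup>2" unfolding A_def Q_def using t by (intro batch_mean_bounds; simp)+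
      have BP: "1 / \<Lambda>\<^sup>2 \<le> B * P" "B * P \<le> \<Lambda>\<^sup>2"
        unfolding B_def P_def using t by (intro sw.batch_mean_bounds; simp)+
      have pos: "0 < P" "0 < Q" using t by (auto simp: P_def Q_def p_pos q_pos)
      have "0 < 1 / \<Lambda>\<^sup>2" using L by simp
      then have "0 < A * Q" "0 < B * P" using AQ(1) BP(1) by linarith+
      then have AB: "0 < A" "0 < B" using pos by (auto simp: zero_less_mult_iff)
      have eq: "p (Suc t) x * q (Suc t) y
          = (1 - e)\<^sup>2 * (P * Q) + e * (1 - e) * (A * Q + B * P) + e\<^sup>2 * (A * B)"
        by (simp add: p_step q_step t A_def B_def P_def Q_def e_def power2_eq_square algebra_simps)
      have "\<rho> \<le> (1 - e)\<^sup>2 * \<rho> + e * (1 - e) * (2 * \<rho> + 2 * \<rho>)"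
      proof -
        have "0 \<le> \<rho> * (e * (2 - 3 * e))" using e \<rho> by simp
        then show ?thesis by (simp add: algebra_simps power2_eq_square)
      qed
      also have "\<dots> \<le> (1 - e)\<^sup>2 * (P * Q) + e * (1 - e) * (A * Q + B * P)"
        using PQ AQ BP \<rho> e by (intro add_mono mult_left_mono) auto
      also have "\<dots> \<le> p (Suc t) x * q (Suc t) y"
        unfolding eq using AB by simp
      finally have low: "\<rho> \<le> p (Suc t) x * q (Suc t) y" .
      have "A * B \<le> U"
      proof -
        have "(A * B) * \<rho> \<le> (A * B) * (P * Q)" using PQ AB by (intro mult_left_mono) auto
        also have "\<dots> = (A * Q) * (B * P)" by simp
        also have "\<dots> \<le> \<Lambda>\<^sup>2 * \<Lambda>\<^sup>2"
          using AQ BP AB pos by (intro mult_mono) auto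
        finally have "A * B \<le> \<Lambda>\<^sup>2 * \<Lambda>\<^sup>2 / \<rho>" using \<rho>(1) by (simp add: pos_le_divide_eq)
        then show ?thesis using U(3) by linarith
      qed
      then have "p (Suc t) x * q (Suc t) y \<le> (1 - e)\<^sup>2 * U + e * (1 - e) * (U + U) + e\<^sup>2 * U"
        unfolding eq using PQ AQ BP U e by (intro add_mono mult_left_mono) auto
      also have "\<dots> = U" by (simp add: power2_eq_square algebra_simps)
      finally show "\<rho> \<le> p (Suc t) x * q (Suc t) y \<and> p (Suc t) x * q (Suc t) y \<le> U"
        using low by simp
    qed
  qed
  define R where "R = max 2 (max U (1 / \<rho>))"
  have R: "2 \<le> R" "U \<le> R" "1 / \<rho> \<le> R" by (auto simp: R_def)
  then have "1 / R \<le> \<rho>" using \<rho> by (simp add: field_simps)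
  have "\<eta> t \<le> 1/2 \<and> (\<forall>x y. 1 / R \<le> p t x * q t y \<and> p t x * q t y \<le> R)" if "t0 \<le> t" for t
  proof (intro conjI allI)
    show "\<eta> t \<le> 1/2" using t0 that by simp
    show "1 / R \<le> p t x * q t y" for x y
      using main[rule_format, OF that, of x y] \<open>1 / R \<le> \<rho>\<close> by simp
    show "p t x * q t y \<le> R" for x y
      using main[rule_format, OF that, of x y] R by simp
  qed
  then show ?thesis by (intro exI[of _ t0] exI[of _ R] conjI allI impI t0(1) R(1)) auto
qed

end

section \<open>Convergence of the averaged dynamics\<close>

lemma abs_diff_le_of_near:
  fixes u v z :: real
  assumes "exp (- z) * v \<le> u" "u \<le> exp z * v" "0 \<le> v" "z \<le> w"
  shows "\<bar>u - v\<bar> \<le> (exp w - 1) * v"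
proof -
  have "u - v \<le> (exp w - 1) * v"
    using assms mult_right_mono[of "exp z" "exp w" v] by (simp add: left_diff_distrib)
  moreover have "v - u \<le> (exp w - 1) * v"
  proof -
    have "1 - z \<le> exp (- z)" "1 + z \<le> exp z" using exp_ge_add_one_self[of "- z"] exp_ge_add_one_self[of z] by auto
    then have "1 - exp (- z) \<le> exp w - 1" using assms(4) exp_le_cancel_iff[of z w] by linarith
    then have "(1 - exp (- z)) * v \<le> (exp w - 1) * v" using assms(3) by (intro mult_right_mono)
    then show ?thesis using assms(1) by (simp add: left_diff_distrib)
  qed
  ultimately show ?thesis by linarith
qed

context sinkhorn_dynamics begin

text \<open>The state reached by \<open>product_bounded\<close>, as a predicate that is symmetric in \<open>p\<close> and
\<open>q\<close>. It makes \<open>1 / q\<close> comparable to \<open>p\<close>, so that both terms of an update have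
the same order of magnitude.\<close>

definition balanced :: "real \<Rightarrow> nat \<Rightarrow> bool" where
  "balanced R t0 \<longleftrightarrow> 0 < t0 \<and> 2 \<le> R \<and>
     (\<forall>t\<ge>t0. \<eta> t \<le> 1/2 \<and> (\<forall>x y. 1 / R \<le> p t x * q t y \<and> p t x * q t y \<le> R))"

lemma ex_balanced: "\<exists>R t0. balanced R t0"
  using product_bounded unfolding balanced_def by blast

lemma balanced_swap: "balanced R t0 \<Longrightarrow> sinkhorn_dynamics.balanced \<eta> q p R t0"
  unfolding balanced_def sinkhorn_dynamics.balanced_def[OF swap] by (simp add: mult.commute)

lemma balancedD:
  assumes "balanced R t0" "t0 \<le> t"
  shows "0 < t" "2 \<le> R" "\<eta> t \<le> 1/2" "1 / q t y \<le> R * p t x" "p t x / R \<le> 1 / q t y"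
proof -
  show t: "0 < t" and R: "2 \<le> R" and "\<eta> t \<le> 1/2" using assms by (auto simp: balanced_def)
  have *: "1 / R \<le> p t x * q t y" "p t x * q t y \<le> R" using assms by (auto simp: balanced_def)
  show "1 / q t y \<le> R * p t x" "p t x / R \<le> 1 / q t y" using * R q_pos[OF t, of y] by (simp_all add: field_simps)
qed

text \<open>An upper bound on the relative speed, per unit of clock time, at which \<open>p\<close> and \<open>q\<close>
change.\<close>

definition rate :: "real \<Rightarrow> real" where "rate R = \<Lambda>\<^sup>2 * R"

lemma rate_ge: "2 \<le> R \<Longrightarrow> 2 \<le> rate R" "2 \<le> R \<Longrightarrow> \<Lambda> * R \<le> rate R"
proof -
  assume R: "2 \<le> R"
  have L: "1 \<le> \<Lambda>" by (rule \<Lambda>_ge_1)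
  then have "\<Lambda> \<le> \<Lambda>\<^sup>2" by (simp add: power2_eq_square)
  then show "\<Lambda> * R \<le> rate R" using R by (simp add: rate_def)
  have "1 * R \<le> \<Lambda> * R" using R L by (intro mult_right_mono) auto
  with \<open>\<Lambda> * R \<le> rate R\<close> R show "2 \<le> rate R" by linarith
qed

lemma batch_mean_le_rate:
  assumes "balanced R t0" "t0 \<le> a"
  shows "batch_mean ys (I s) (\<lambda>y. k x y / q a y) \<le> rate R * p a x"
proof -
  note b = balancedD[OF assms]
  have "batch_mean ys (I s) (\<lambda>y. k x y / q a y) \<le> \<Lambda>\<^sup>2 * (1 / q a x)"
    using batch_mean_bounds(2)[OF b(1), of s x x] q_pos[OF b(1), of x] by (simp add: field_simps)
  also have "\<dots> \<le> \<Lambda>\<^sup>2 * (R * p a x)"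
    by (intro mult_left_mono b(4)) simp
  finally show ?thesis by (simp add: rate_def)
qed

text \<open>Relative changes are at most exponential in clock time. Growth is limited by
\<open>batch_mean_le_rate\<close>; decay at most by the factor \<open>1 - \<eta>\<close> per step, because the added
term is positive.\<close>

lemma drift:
  assumes "balanced R t0" "t0 \<le> a" "a \<le> t"
  shows "exp (- (rate R * sum \<eta> {a..<t})) * p a x \<le> p t x \<and> p t x \<le> exp (rate R * sum \<eta> {a..<t}) * p a x"
  using assms(3)
proof (induction t rule: dec_induct)
  case (step t)
  have at: "t0 \<le> t" using step assms by simp
  note b = balancedD[OF assms(1) at]
  have e: "0 \<le> \<eta> t" "\<eta> t \<le> 1/2" using b(1,3) \<eta>_nonneg by auto
  have r: "2 \<le> rate R" by (rule rate_ge(1)[OF b(2)])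
  note m = batch_mean_le_rate[OF assms(1) at, of t x]
  have m0: "0 \<le> batch_mean ys (I t) (\<lambda>y. k x y / q t y)"
    using batch_mean_bounds(1)[OF b(1), of t x x] q_pos[OF b(1), of x]
    by (meson divide_nonneg_nonneg order_trans zero_le_mult_iff zero_le_one zero_le_power2 not_less)
  note pt = p_pos[OF b(1), of x]
  have S: "sum \<eta> {a..<Suc t} = sum \<eta> {a..<t} + \<eta> t" using step by simp
  have "p (Suc t) x \<le> p t x + \<eta> t * (rate R * p t x)"
    using mult_left_mono[OF m e(1)] mult_nonneg_nonneg[OF e(1), of "p t x"] pt
    unfolding p_step[OF b(1)] by (simp add: left_diff_distrib)
  also have "\<dots> = (1 + rate R * \<eta> t) * p t x" by (simp add: algebra_simps)
  also have "\<dots> \<le> exp (rate R * \<eta> t) * p t x"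
    using pt by (intro mult_right_mono exp_ge_add_one_self) auto
  also have "\<dots> \<le> exp (rate R * \<eta> t) * (exp (rate R * sum \<eta> {a..<t}) * p a x)"
    using step.IH by (intro mult_left_mono) auto
  finally have up: "p (Suc t) x \<le> exp (rate R * sum \<eta> {a..<Suc t}) * p a x"
    unfolding S by (simp add: exp_add ring_distribs mult_ac)
  have "exp (- (rate R * \<eta> t)) \<le> 1 - \<eta> t"
  proof -
    have "1 \<le> (1 - \<eta> t) * (1 + 2 * \<eta> t)"
      using mult_nonneg_nonneg[OF e(1), of "1 - 2 * \<eta> t"] e by (simp add: algebra_simps)
    also have "\<dots> \<le> (1 - \<eta> t) * exp (2 * \<eta> t)"
      using e by (intro mult_left_mono exp_ge_add_one_self) auto
    also have "\<dots> \<le> (1 - \<eta> t) * exp (rate R * \<eta> t)"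
      using e r by (intro mult_left_mono) (auto intro: mult_right_mono)
    finally show ?thesis by (simp add: exp_minus field_simps)
  qed
  then have "exp (- (rate R * \<eta> t)) * (exp (- (rate R * sum \<eta> {a..<t})) * p a x) \<le> (1 - \<eta> t) * p t x"
    using step.IH e p_pos[of a x] assms(2) b(1) balancedD(1)[OF assms(1) assms(2)] by (intro mult_mono) auto
  also have "\<dots> \<le> p (Suc t) x"
    unfolding p_step[OF b(1)] using e(1) m0 by simp
  finally have "exp (- (rate R * sum \<eta> {a..<Suc t})) * p a x \<le> p (Suc t) x"
    unfolding S by (simp add: exp_add exp_diff exp_minus ring_distribs field_simps)
  with up show ?case by blast
qed simp

text \<open>The relative error per unit of clock time in \<open>window_step\<close>. The first summand comes from freezing
\<open>p\<close> and \<open>q\<close> during a window, the second from the sampling noise. What matters is that it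
tends to 0 with \<open>\<tau>\<close>.\<close>

definition block_error :: "real \<Rightarrow> real \<Rightarrow> real" where
  "block_error R \<tau> = (exp (2 * rate R * \<tau>) - 1) * (rate R + 1) + rate R * \<tau>"

text \<open>
  The threshold \<open>\<tau>\<^sup>2 / 2\<close> is at most \<open>\<tau>\<close> times the clock time that a late
  window takes.
\<close>

definition small_noise where
  "small_noise \<tau> i \<longleftrightarrow> (\<forall>\<phi>. log_lipschitz (2 * K) \<phi> \<longrightarrow> (\<forall>z. \<phi> z \<le> 1) \<longrightarrow>
      \<bar>\<Sum>s\<in>window \<tau> i. \<eta> s * (batch_mean xs (I s) \<phi> - (LINT z|\<alpha>. \<phi> z))\<bar> \<le> \<tau>\<^sup>2 / 2 \<and>
      \<bar>\<Sum>s\<in>window \<tau> i. \<eta> s * (batch_mean ys (I s) \<phi> - (LINT z|\<beta>. \<phi> z))\<bar> \<le> \<tau>\<^sup>2 / 2)"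

definition good_window where
  "good_window R t0 \<tau> i \<longleftrightarrow> balanced R t0 \<and> 0 < \<tau> \<and> t0 \<le> win \<tau> i \<and>
     \<tau> / 2 \<le> sum \<eta> (window \<tau> i) \<and> sum \<eta> (window \<tau> i) \<le> 2 * \<tau> \<and> small_noise \<tau> i"

lemma good_window_swap:
  "good_window R t0 \<tau> i \<Longrightarrow> sinkhorn_dynamics.good_window \<eta> K \<beta> \<alpha> I ys xs q p R t0 \<tau> i"
  using balanced_swap
  unfolding good_window_def sinkhorn_dynamics.good_window_def[OF swap]
    small_noise_def sinkhorn_dynamics.small_noise_def[OF swap] by blast

lemma window_drift:
  assumes g: "good_window R t0 \<tau> i" and s: "s \<in> {win \<tau> i..win \<tau> (Suc i)}"
  defines "w \<equiv> exp (2 * rate R * \<tau>)"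
  shows "p s x \<le> w * p (win \<tau> i) x" "p (win \<tau> i) x \<le> w * p s x"
    "\<bar>p s x - p (win \<tau> i) x\<bar> \<le> (w - 1) * p (win \<tau> i) x"
    "\<bar>1 / p s x - 1 / p (win \<tau> i) x\<bar> \<le> (w - 1) * (1 / p (win \<tau> i) x)"
proof -
  define a where "a = win \<tau> i"
  define z where "z = rate R * sum \<eta> {a..<s}"
  have b: "balanced R t0" "t0 \<le> a" "a \<le> s" using g s by (auto simp: good_window_def a_def)
  note d = balancedD[OF b(1,2)]
  have "sum \<eta> {a..<s} \<le> sum \<eta> (window \<tau> i)"
    unfolding a_def using s d(1) by (intro sum_mono2) (auto intro!: \<eta>_nonneg simp: a_def)
  also have "\<dots> \<le> 2 * \<tau>" using g by (simp add: good_window_def)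
  finally have zw: "z \<le> 2 * rate R * \<tau>"
    unfolding z_def using rate_ge(1)[OF d(2)] by (simp add: mult.assoc mult.left_commute[of 2])
  have pos: "0 < p s x" "0 < p a x" using d b by (auto intro: p_pos)
  have near: "exp (- z) * p a x \<le> p s x" "p s x \<le> exp z * p a x"
    using drift[OF b, of x] by (auto simp: z_def)
  then have near': "p a x \<le> exp z * p s x" by (simp add: exp_minus field_simps)
  show "\<bar>p s x - p (win \<tau> i) x\<bar> \<le> (w - 1) * p (win \<tau> i) x"
    unfolding w_def a_def[symmetric] using near pos zw by (intro abs_diff_le_of_near) auto
  show "\<bar>1 / p s x - 1 / p (win \<tau> i) x\<bar> \<le> (w - 1) * (1 / p (win \<tau> i) x)"
    unfolding w_def a_def[symmetric] using near near' pos zw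
    by (intro abs_diff_le_of_near[where z = z]) (auto simp: exp_minus field_simps)
  have "exp z \<le> w" using zw by (simp add: w_def)
  then have "exp z * p a x \<le> w * p a x" "exp z * p s x \<le> w * p s x"
    using pos by (auto intro: mult_right_mono)
  then show "p s x \<le> w * p (win \<tau> i) x" "p (win \<tau> i) x \<le> w * p s x"
    using near near' by (auto simp: a_def)
qed

text \<open>A whole window acts like a single step of size \<open>h\<close> with the exact integral in place of batch
means. With \<open>p\<close> and \<open>q\<close> frozen at the start of the window, the sum of the updates is
\<open>h\<close> times the exact update plus the noise of the single test function \<open>k x / q\<^sub>a\<close>; the three
estimates in the proof bound the two effects of freezing and this noise.\<close>

lemma window_step:
  assumes g: "good_window R t0 \<tau> i"
  defines "a \<equiv> win \<tau> i" and "b \<equiv> win \<tau> (Suc i)" and "h \<equiv> sum \<eta> (window \<tau> i)"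
  shows "\<bar>p b x - ((1 - h) * p a x + h * (LINT y|\<beta>. k x y * (1 / q a y)))\<bar>
           \<le> h * block_error R \<tau> * p a x"
proof -
  interpret sw: sinkhorn_dynamics \<eta> "\<lambda>x y. k y x" K \<beta> \<alpha> I ys xs q p by (rule swap)
  have bal: "balanced R t0" "t0 \<le> a" and \<tau>: "0 < \<tau>" using g by (auto simp: good_window_def a_def)
  note d = balancedD[OF bal]
  have ab: "a \<le> b" unfolding a_def b_def using \<tau> by (intro win_mono) auto
  define w where "w = exp (2 * rate R * \<tau>)"
  have w1: "0 \<le> w - 1" using rate_ge(1)[OF d(2)] \<tau> by (simp add: w_def)
  define A where "A = (LINT y|\<beta>. k x y * (1 / q a y))"
  define m where "m r s = batch_mean ys (I s) (\<lambda>y. k x y / q r y)" for r s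
  have pa: "0 < p a x" using d(1) by (rule p_pos)
  have \<eta>s: "0 \<le> \<eta> s" if "s \<in> {a..<b}" for s using that d(1) by (intro \<eta>_nonneg) auto
  have "p b x - p a x = (\<Sum>s = a..<b. p (Suc s) x - p s x)"
    using sum_Suc_diff'[OF ab, of "\<lambda>s. p s x"] by simp
  also have "\<dots> = (\<Sum>s = a..<b. \<eta> s * (m s s - m a s) + \<eta> s * (m a s - A) + \<eta> s * (A - p a x)
      - \<eta> s * (p s x - p a x))"
    by (intro sum.cong refl) (use d(1) in \<open>auto simp: p_step m_def algebra_simps\<close>)
  also have "\<dots> = (\<Sum>s = a..<b. \<eta> s * (m s s - m a s)) + (\<Sum>s = a..<b. \<eta> s * (m a s - A))
      + h * (A - p a x) - (\<Sum>s = a..<b. \<eta> s * (p s x - p a x))"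
    by (simp add: sum.distrib sum_subtractf h_def a_def b_def sum_distrib_right)
  finally have eq: "p b x - ((1 - h) * p a x + h * A) = (\<Sum>s = a..<b. \<eta> s * (m s s - m a s))
      + (\<Sum>s = a..<b. \<eta> s * (m a s - A)) - (\<Sum>s = a..<b. \<eta> s * (p s x - p a x))"
    by (simp add: algebra_simps)
  have bound: "\<bar>\<Sum>s = a..<b. \<eta> s * v s\<bar> \<le> h * c" if "\<And>s. s \<in> {a..<b} \<Longrightarrow> \<bar>v s\<bar> \<le> c" for v c
  proof -
    have "\<bar>\<Sum>s = a..<b. \<eta> s * v s\<bar> \<le> (\<Sum>s = a..<b. \<eta> s * c)"
      by (rule order_trans[OF sum_abs]) (auto intro!: sum_mono mult_left_mono that simp: abs_mult \<eta>s)
    then show ?thesis by (simp add: h_def a_def b_def sum_distrib_right)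
  qed
  have 1: "\<bar>\<Sum>s = a..<b. \<eta> s * (m s s - m a s)\<bar> \<le> h * ((w - 1) * (rate R * p a x))"
  proof (rule bound)
    fix s assume s: "s \<in> {a..<b}"
    have "\<bar>m s s - m a s\<bar> \<le> batch_mean ys (I s) (\<lambda>y. (w - 1) * (k x y / q a y))"
      unfolding m_def batch_mean_diff[symmetric]
    proof (rule batch_mean_abs_le)
      fix y
      have "\<bar>1 / q s y - 1 / q a y\<bar> \<le> (w - 1) * (1 / q a y)"
        unfolding w_def a_def using s
        by (intro sw.window_drift(4)[OF good_window_swap[OF g], unfolded sw.rate_def, folded rate_def])
          (auto simp: a_def b_def)
      then have "k x y * \<bar>1 / q s y - 1 / q a y\<bar> \<le> k x y * ((w - 1) * (1 / q a y))"
        using log_lipschitz_pos[OF k_right, of x y] by (intro mult_left_mono) auto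
      moreover have "k x y * \<bar>1 / q s y - 1 / q a y\<bar> = \<bar>k x y * (1 / q s y - 1 / q a y)\<bar>"
        using log_lipschitz_pos[OF k_right, of x y] by (simp add: abs_mult)
      moreover have "k x y * (1 / q s y - 1 / q a y) = k x y / q s y - k x y / q a y"
        by (simp add: right_diff_distrib)
      ultimately show "\<bar>k x y / q s y - k x y / q a y\<bar> \<le> (w - 1) * (k x y / q a y)"
        by (simp add: mult_ac)
    qed
    also have "\<dots> = (w - 1) * m a s" by (simp only: batch_mean_cmult m_def)
    also have "\<dots> \<le> (w - 1) * (rate R * p a x)"
      unfolding m_def by (intro mult_left_mono w1 batch_mean_le_rate[OF bal])
    finally show "\<bar>m s s - m a s\<bar> \<le> (w - 1) * (rate R * p a x)" .
  qed
  have 2: "\<bar>\<Sum>s = a..<b. \<eta> s * (p s x - p a x)\<bar> \<le> h * ((w - 1) * p a x)"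
    unfolding w_def a_def by (rule bound[unfolded a_def], rule window_drift[OF g]) (auto simp: a_def b_def)
  have 3: "\<bar>\<Sum>s = a..<b. \<eta> s * (m a s - A)\<bar> \<le> h * (rate R * \<tau> * p a x)"
  proof -
    define c where "c = rate R * p a x"
    have c: "0 < c" using pa rate_ge(1)[OF d(2)] by (simp add: c_def)
    \<comment> \<open>Dividing by \<open>c\<close> brings the test function below 1, and makes the error relative to \<open>p a x\<close>.\<close>
    define \<phi> where "\<phi> = (\<lambda>y. (1 / c) * (k x y * (1 / q a y)))"
    have "log_lipschitz (K + K) \<phi>"
      unfolding \<phi>_def using c d(1)
      by (intro log_lipschitz_scale log_lipschitz_mult log_lipschitz_inverse k_right log_lipschitz_q) auto
    moreover have "\<phi> y \<le> 1" for y
    proof -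
      have "k x y * (1 / q a y) \<le> \<Lambda> * (R * p a x)"
        using k_bounds(2)[of x y] d(4)[of y x] \<Lambda>_ge_1 q_pos[OF d(1), of y] by (intro mult_mono) auto
      also have "\<dots> \<le> c" unfolding c_def using rate_ge(2)[OF d(2)] pa by (simp add: mult.assoc[symmetric])
      finally have "1 / c * (k x y * (1 / q a y)) \<le> 1 / c * c" using c by (intro mult_left_mono) auto
      then show ?thesis using c by (simp only: \<phi>_def) simp
    qed
    ultimately have "\<bar>\<Sum>s\<in>window \<tau> i. \<eta> s * (batch_mean ys (I s) \<phi> - (LINT z|\<beta>. \<phi> z))\<bar> \<le> \<tau>\<^sup>2 / 2"
      using g unfolding good_window_def small_noise_def by (simp flip: mult_2)
    moreover have "batch_mean ys (I s) \<phi> - (LINT z|\<beta>. \<phi> z) = (m a s - A) / c" for s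
      unfolding \<phi>_def m_def A_def by (simp only: batch_mean_cmult integral_mult_right_zero) (simp add: diff_divide_distrib)
    ultimately have "\<bar>\<Sum>s = a..<b. \<eta> s * (m a s - A)\<bar> / c \<le> \<tau>\<^sup>2 / 2"
      using c by (simp add: a_def b_def sum_divide_distrib[symmetric])
    then have "\<bar>\<Sum>s = a..<b. \<eta> s * (m a s - A)\<bar> \<le> \<tau> / 2 * (\<tau> * c)"
      using c by (simp add: field_simps power2_eq_square)
    also have "\<dots> \<le> h * (\<tau> * c)"
      using g c \<tau> unfolding h_def good_window_def by (intro mult_right_mono) auto
    finally show ?thesis by (simp add: c_def mult_ac)
  qed
  have "\<bar>p b x - ((1 - h) * p a x + h * A)\<bar>
      \<le> h * ((w - 1) * (rate R * p a x)) + h * (rate R * \<tau> * p a x) + h * ((w - 1) * p a x)"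
    unfolding eq using 1 2 3 by linarith
  also have "\<dots> = h * block_error R \<tau> * p a x"
    by (simp add: block_error_def w_def algebra_simps)
  finally show ?thesis unfolding A_def .
qed

text \<open>The excess at which contraction and error balance in \<open>window_contracts\<close>.\<close>

definition residual :: "real \<Rightarrow> real \<Rightarrow> real" where
  "residual R \<tau> = (4 + 4 * \<Lambda>) * block_error R \<tau> * (\<Lambda> * rate R)"

text \<open>The lower bound \<open>\<tau> / 2\<close> on the clock time of a window, times the lower bound
\<open>1 / \<Lambda>\<close> on the kernel, times the lower bound \<open>1 / rate R\<close> on the size of an update
relative to \<open>p\<close>.\<close>

definition contraction :: "real \<Rightarrow> real \<Rightarrow> real" where
  "contraction R \<tau> = \<tau> / (2 * \<Lambda> * rate R)"

lemma block_error_pos: "2 \<le> R \<Longrightarrow> 0 < \<tau> \<Longrightarrow> 0 < block_error R \<tau>"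
  unfolding block_error_def using rate_ge(1)[of R]
  by (intro add_nonneg_pos mult_nonneg_nonneg mult_pos_pos) auto

text \<open>Over one window, the excess moves towards the residual by a fixed fraction. This combines
\<open>window_step\<close> with \<open>kernel_contracts_ratio\<close> through \<open>perturbed_step_ratio\<close>. It is
here that \<open>p\<close> and \<open>q\<close> must have the same bound \<open>E\<close>: the update of \<open>p\<close>
averages \<open>1 / q\<close>, so the excess of \<open>p\<close> alone need not decrease.\<close>

lemma window_contracts:
  assumes g: "good_window R t0 \<tau> i" and \<tau>: "\<tau> \<le> 1/4" and res: "residual R \<tau> \<le> 1"
    and E: "ratio_le E (p (win \<tau> i))" "ratio_le E (q (win \<tau> i))" "residual R \<tau> \<le> E" "E \<le> residual R \<tau> + \<Lambda>"
  shows "ratio_le (E - contraction R \<tau> * (E - residual R \<tau>)) (p (win \<tau> (Suc i)))"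
  unfolding ratio_le_def
proof (intro allI)
  fix x x'
  define a where "a = win \<tau> i"
  define h where "h = sum \<eta> (window \<tau> i)"
  define A where "A x = (LINT y|\<beta>. k x y * (1 / q a y))" for x
  define r where "r = residual R \<tau>" define e where "e = block_error R \<tau>"
  define \<gamma> where "\<gamma> = 1 / (\<Lambda> * rate R)"
  have bal: "balanced R t0" "t0 \<le> a" and h: "0 < \<tau>" "\<tau> / 2 \<le> h" "h \<le> 2 * \<tau>"
    using g by (auto simp: good_window_def a_def h_def)
  note d = balancedD[OF bal]
  have rR: "2 \<le> rate R" by (rule rate_ge(1)[OF d(2)])
  have L: "1 \<le> \<Lambda>" by (rule \<Lambda>_ge_1)
  have e0: "0 < e" unfolding e_def using d(2) h(1) by (rule block_error_pos)
  have \<gamma>: "0 < \<gamma>" "\<gamma> \<le> 1" "contraction R \<tau> = \<gamma> * (\<tau> / 2)" "(4 + 4 * \<Lambda>) * e = \<gamma> * r"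
  proof -
    have "0 < \<Lambda> * rate R" using L rR by simp
    moreover have "1 * 1 \<le> \<Lambda> * rate R" using L rR by (intro mult_mono) auto
    ultimately show "0 < \<gamma>" "\<gamma> \<le> 1" "contraction R \<tau> = \<gamma> * (\<tau> / 2)" "(4 + 4 * \<Lambda>) * e = \<gamma> * r"
      using L rR by (simp_all add: \<gamma>_def contraction_def r_def residual_def e_def)
  qed
  have r0: "0 \<le> r" unfolding r_def residual_def using L rR e0 by (simp add: e_def)
  define E' where "E' = E - contraction R \<tau> * (E - r)"
  have Er: "r \<le> E" "E \<le> 1 + \<Lambda>" using E res by (auto simp: r_def)
  have ct: "0 \<le> contraction R \<tau>" "contraction R \<tau> \<le> 1"
    unfolding \<gamma>(3) using \<gamma>(1,2) h(1) \<tau> mult_mono[of \<gamma> 1 "\<tau> / 2" 1] by auto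
  have E'1: "E' \<le> 1 + \<Lambda>" unfolding E'_def using mult_nonneg_nonneg[OF ct(1), of "E - r"] Er by linarith
  have E'2: "0 \<le> E'" unfolding E'_def using mult_right_mono[OF ct(2), of "E - r"] Er(1) r0 by simp
  \<comment> \<open>Balance guarantees that the update has a positive weight in the mean.\<close>
  have A_ge: "1 / rate R * p a x' \<le> A x'"
  proof -
    interpret \<beta>: prob_space \<beta> by (rule \<beta>)
    have "1 / \<Lambda>\<^sup>2 * (p a x' / R) \<le> k x' y * (1 / q a y)" for y
    proof -
      have "1 / \<Lambda>\<^sup>2 * (p a x' / R) \<le> 1 / \<Lambda>\<^sup>2 * (1 / q a y)"
        by (intro mult_left_mono d(5)) simp
      also have "\<dots> \<le> k x' y * (1 / q a y)"
        using k_div_q_bounds(1)[OF d(1), of x' y y] q_pos[OF d(1), of y] by (intro mult_right_mono) auto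
      finally show ?thesis .
    qed
    then have "(LINT y|\<beta>. 1 / \<Lambda>\<^sup>2 * (p a x' / R)) \<le> A x'"
      unfolding A_def using d(1) q_pos[OF d(1)]
      by (intro integral_mono integrable_\<beta> continuous_intros k_continuous log_lipschitz_continuous[OF log_lipschitz_q K_nonneg])
        (auto simp: less_imp_neq[THEN not_sym])
    then show ?thesis by (simp add: \<beta>.prob_space rate_def)
  qed
  have A_ratio: "A x \<le> (1 + (1 - 1 / \<Lambda>) * E) * A x'"
    unfolding A_def
    by (intro ratio_leD[OF kernel_contracts_ratio[OF compact \<beta>]] k_continuous k_\<beta> k_bounds ratio_le_inverse)
      (use L E(2) q_pos[OF d(1)] d(1) in \<open>auto simp: a_def[symmetric] less_imp_neq[THEN not_sym]
        intro!: continuous_intros log_lipschitz_continuous[OF log_lipschitz_q K_nonneg] ratio_le_inverse\<close>)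
  have step: "\<bar>p (win \<tau> (Suc i)) z - ((1 - h) * p a z + h * A z)\<bar> \<le> h * e * p a z" for z
    using window_step[OF g, of z] by (simp add: a_def h_def A_def e_def)
  have "p (win \<tau> (Suc i)) x \<le> (1 + E') * p (win \<tau> (Suc i)) x'"
  proof (rule perturbed_step_ratio[where ?p1.0 = "p a x" and ?p2.0 = "p a x'" and ?A1.0 = "A x"
      and ?A2.0 = "A x'" and h = h and e = e and E = E and \<delta> = "1 / \<Lambda>" and c = "1 / rate R"
      and \<Lambda> = \<Lambda> and F = "1 + \<Lambda>"])
    show "0 < p a x'" "0 \<le> p a x" using p_pos[OF d(1)] less_imp_le by blast+
    then have "0 < 1 / rate R * p a x'" using rR by simp
    then show "0 < A x'" using A_ge by linarith
    show "p a x \<le> (1 + E) * p a x'" using E(1) unfolding a_def by (rule ratio_leD)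
    show "p a x \<le> \<Lambda> * p a x'" by (rule log_lipschitz_le_\<Lambda>[OF log_lipschitz_p[OF d(1)]])
    show "E - 1 / \<Lambda> * (1 / rate R) * h * E + 2 * (1 + (1 + \<Lambda>) + \<Lambda>) * h * e \<le> E'"
    proof -
      have "0 \<le> \<gamma> * ((h - \<tau> / 2) * (E - r))" using \<gamma> h Er by simp
      moreover have "2 * (1 + (1 + \<Lambda>) + \<Lambda>) * h * e = \<gamma> * r * h"
        unfolding \<gamma>(4)[symmetric] by (simp add: algebra_simps)
      moreover have "1 / \<Lambda> * (1 / rate R) = \<gamma>" by (simp add: \<gamma>_def)
      ultimately show ?thesis unfolding E'_def \<gamma>(3) by (simp add: algebra_simps)
    qed
  qed (use A_ratio A_ge L rR h \<tau> e0 Er r0 E'1 E'2 step[of x] step[of x'] in \<open>auto simp: abs_le_iff\<close>)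
  then show "p (win \<tau> (Suc i)) x \<le> (1 + (E - contraction R \<tau> * (E - residual R \<tau>))) * p (win \<tau> (Suc i)) x'"
    by (simp add: E'_def r_def)
qed

lemma block_error_tendsto_0: "(block_error R \<longlongrightarrow> 0) (at_right 0)"
proof -
  have "((\<lambda>\<tau>. (exp (2 * rate R * \<tau>) - 1) * (rate R + 1) + rate R * \<tau>) \<longlongrightarrow>
      (exp (2 * rate R * 0) - 1) * (rate R + 1) + rate R * 0) (at_right 0)"
    by (intro tendsto_intros)
  then show ?thesis by (simp add: block_error_def[abs_def])
qed

lemma eventually_good_window:
  assumes "balanced R t0" and \<tau>: "\<tau> = 1 / real (Suc j)"
  shows "\<forall>\<^sub>F i in sequentially. good_window R t0 \<tau> i"
proof -
  have t: "0 < \<tau>" "0 < \<tau>\<^sup>2 / 2" using \<tau> by simp_all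
  show ?thesis
    using equi_x[unfolded equidistributed_def, rule_format, OF t(2), of j]
      equi_y[unfolded equidistributed_def, rule_format, OF t(2), of j]
      eventually_window_length[OF t(1)] eventually_win_ge[OF t(1), of t0]
    by eventually_elim (use assms t in \<open>auto simp: good_window_def small_noise_def\<close>)
qed

text \<open>Iterating \<open>window_contracts\<close> from the a priori excess \<open>\<Lambda>\<close> gives geometric decay towards the
residual.\<close>

lemma eventually_ratio_le_residual:
  assumes bal: "balanced R t0" and \<tau>: "\<tau> = 1 / real (Suc j)" "\<tau> \<le> 1/4" and res: "residual R \<tau> \<le> 1"
  shows "\<forall>\<^sub>F i in sequentially. good_window R t0 \<tau> i \<and>
    ratio_le (2 * residual R \<tau>) (p (win \<tau> i)) \<and> ratio_le (2 * residual R \<tau>) (q (win \<tau> i))"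
proof -
  interpret sw: sinkhorn_dynamics \<eta> "\<lambda>x y. k y x" K \<beta> \<alpha> I ys xs q p by (rule swap)
  obtain i0 where good: "\<And>i. i0 \<le> i \<Longrightarrow> good_window R t0 \<tau> i"
    using eventually_good_window[OF bal \<tau>(1)] by (auto simp: eventually_sequentially)
  define r where "r = residual R \<tau>"
  define g where "g = contraction R \<tau>"
  define E where "E m = r + (1 - g) ^ m * \<Lambda>" for m
  have R: "2 \<le> R" and t0: "0 < t0" using bal by (auto simp: balanced_def)
  have rR: "2 \<le> rate R" by (rule rate_ge(1)[OF R])
  have L: "1 \<le> \<Lambda>" by (rule \<Lambda>_ge_1)
  have \<tau>0: "0 < \<tau>" using \<tau> by simp
  have r0: "0 < r" using block_error_pos[OF R \<tau>0] L rR by (simp add: r_def residual_def add_pos_pos)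
  have g: "0 < g" "g < 1"
  proof -
    show "0 < g" using \<tau>0 L rR by (simp add: g_def contraction_def)
    have "1 * 1 \<le> \<Lambda> * rate R" using L rR by (intro mult_mono) auto
    then show "g < 1" using \<tau>(2) \<tau>0 L rR by (simp add: g_def contraction_def)
  qed
  have pos: "0 < win \<tau> i" if "i0 \<le> i" for i using good[OF that] t0 by (simp add: good_window_def)
  have main: "ratio_le (E m) (p (win \<tau> (i0 + m))) \<and> ratio_le (E m) (q (win \<tau> (i0 + m)))" for m
  proof (induction m)
    case 0
    have "ratio_le (r + \<Lambda>) \<phi>" if "log_lipschitz K \<phi>" for \<phi> :: "'a \<Rightarrow> real"
      unfolding ratio_le_def
    proof (intro allI)
      fix x y
      have "\<Lambda> * \<phi> y \<le> (1 + (r + \<Lambda>)) * \<phi> y"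
        using log_lipschitz_pos[OF that, of y] r0 by (intro mult_right_mono) auto
      then show "\<phi> x \<le> (1 + (r + \<Lambda>)) * \<phi> y" using log_lipschitz_le_\<Lambda>[OF that, of x y] by linarith
    qed
    then show ?case using log_lipschitz_p[OF pos] log_lipschitz_q[OF pos] by (simp add: E_def)
  next
    case (Suc m)
    note gw = good[of "i0 + m"]
    have "0 \<le> (1 - g) ^ m * \<Lambda>" "(1 - g) ^ m * \<Lambda> \<le> 1 * \<Lambda>"
      using g L by (auto intro!: mult_right_mono power_le_one)
    then have E: "residual R \<tau> \<le> E m" "E m \<le> residual R \<tau> + \<Lambda>" by (auto simp: E_def r_def)
    have eq: "E m - contraction R \<tau> * (E m - residual R \<tau>) = E (Suc m)"
      by (simp add: E_def r_def g_def algebra_simps)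
    have "ratio_le (E (Suc m)) (p (win \<tau> (Suc (i0 + m))))"
      unfolding eq[symmetric] using Suc by (intro window_contracts[OF gw \<tau>(2) res _ _ E]) auto
    moreover have "ratio_le (E (Suc m)) (q (win \<tau> (Suc (i0 + m))))"
      unfolding eq[symmetric] using Suc
      by (intro sw.window_contracts[OF good_window_swap[OF gw] \<tau>(2) res _ _ E]) auto
    ultimately show ?case by simp
  qed
  have "(\<lambda>m. (1 - g) ^ m * \<Lambda>) \<longlonglongrightarrow> 0 * \<Lambda>"
    using g by (intro tendsto_intros LIMSEQ_realpow_zero) auto
  then have "\<forall>\<^sub>F m in sequentially. (1 - g) ^ m * \<Lambda> < r"
    using r0 by (intro order_tendstoD) auto
  then obtain m0 where m0: "\<And>m. m0 \<le> m \<Longrightarrow> (1 - g) ^ m * \<Lambda> < r" by (auto simp: eventually_sequentially)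
  have "good_window R t0 \<tau> i \<and> ratio_le (2 * r) (p (win \<tau> i)) \<and> ratio_le (2 * r) (q (win \<tau> i))"
    if "i0 + m0 \<le> i" for i
  proof -
    define m where "m = i - i0"
    have i: "i = i0 + m" "m0 \<le> m" "i0 \<le> i" using that by (auto simp: m_def)
    have "E m \<le> 2 * r" using m0[OF i(2)] by (simp add: E_def)
    then show ?thesis
      using good[OF i(3)] main[of m] pos[OF i(3)] unfolding i(1)
      by (auto intro: ratio_le_mono p_pos q_pos)
  qed
  then show ?thesis unfolding r_def eventually_sequentially by blast
qed

text \<open>The residual tends to 0 with \<open>\<tau>\<close>, and so does the change between the start of a window and
any time inside it. Hence \<open>\<tau>\<close> can be chosen so small that together they account for an excess below
\<open>\<epsilon>\<close>.\<close>

proposition eventually_almost_constant: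
  assumes "0 < \<epsilon>"
  shows "\<forall>\<^sub>F t in sequentially. ratio_le \<epsilon> (p t) \<and> ratio_le \<epsilon> (q t)"
proof -
  interpret sw: sinkhorn_dynamics \<eta> "\<lambda>x y. k y x" K \<beta> \<alpha> I ys xs q p by (rule swap)
  obtain R t0 where bal: "balanced R t0" using ex_balanced by blast
  define w where "w \<tau> = exp (2 * rate R * \<tau>)" for \<tau>
  have R: "2 \<le> R" using bal by (auto simp: balanced_def)
  have res0: "(residual R \<longlongrightarrow> 0) (at_right 0)"
  proof -
    have "((\<lambda>\<tau>. (4 + 4 * \<Lambda>) * block_error R \<tau> * (\<Lambda> * rate R)) \<longlongrightarrow> (4 + 4 * \<Lambda>) * 0 * (\<Lambda> * rate R)) (at_right 0)"
      by (intro tendsto_intros block_error_tendsto_0)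
    then show ?thesis by (simp add: residual_def[abs_def])
  qed
  have "((\<lambda>\<tau>. w \<tau> * (w \<tau> * (1 + 2 * residual R \<tau>))) \<longlongrightarrow>
      exp (2 * rate R * 0) * (exp (2 * rate R * 0) * (1 + 2 * 0))) (at_right 0)"
    unfolding w_def by (intro tendsto_intros res0)
  then have "\<forall>\<^sub>F \<tau> in at_right 0. w \<tau> * (w \<tau> * (1 + 2 * residual R \<tau>)) < 1 + \<epsilon>"
    by (rule order_tendstoD) (use assms in simp)
  moreover have "\<forall>\<^sub>F \<tau> in at_right 0. residual R \<tau> < 1"
    by (rule order_tendstoD[OF res0]) simp
  moreover have "\<forall>\<^sub>F \<tau> in at_right (0::real). \<tau> < 1/4"
    by (rule order_tendstoD[OF tendsto_ident_at]) simp
  ultimately have "\<forall>\<^sub>F \<tau> in at_right 0. w \<tau> * (w \<tau> * (1 + 2 * residual R \<tau>)) < 1 + \<epsilon>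
      \<and> residual R \<tau> < 1 \<and> \<tau> < 1/4" by eventually_elim auto
  then obtain d where d: "0 < d" "\<And>\<tau>. 0 < \<tau> \<Longrightarrow> \<tau> < d \<Longrightarrow>
      w \<tau> * (w \<tau> * (1 + 2 * residual R \<tau>)) < 1 + \<epsilon> \<and> residual R \<tau> < 1 \<and> \<tau> < 1/4"
    by (auto simp: eventually_at_right_field)
  obtain j where j: "inverse (real (Suc j)) < d" using reals_Archimedean[OF d(1)] by blast
  define \<tau> where "\<tau> = 1 / real (Suc j)"
  have \<tau>: "0 < \<tau>" "\<tau> < d" using j by (auto simp: \<tau>_def inverse_eq_divide)
  note small = d(2)[OF \<tau>]
  obtain i0 where i0: "\<And>i. i0 \<le> i \<Longrightarrow> good_window R t0 \<tau> i \<and>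
      ratio_le (2 * residual R \<tau>) (p (win \<tau> i)) \<and> ratio_le (2 * residual R \<tau>) (q (win \<tau> i))"
    using eventually_ratio_le_residual[OF bal \<tau>_def] small by (auto simp: eventually_sequentially)
  have w0: "0 \<le> w \<tau>" by (simp add: w_def)
  \<comment> \<open>Here \<open>\<psi>\<close> is the iterate at the start of the window and \<open>\<phi>\<close> the one at time \<open>t\<close>.\<close>
  have transfer: "ratio_le \<epsilon> \<phi>"
    if pos: "\<And>x. 0 < \<phi> x" "\<And>x. 0 < \<psi> x" and ratio: "ratio_le (2 * residual R \<tau>) \<psi>"
      and near: "\<And>x. \<phi> x \<le> w \<tau> * \<psi> x" "\<And>x. \<psi> x \<le> w \<tau> * \<phi> x" for \<phi> \<psi> :: "'a \<Rightarrow> real"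
    unfolding ratio_le_def
  proof (intro allI)
    fix x y
    have c: "0 \<le> 1 + 2 * residual R \<tau>"
      using ratio_leD[OF ratio, of x x] pos(2)[of x] by (smt (verit) mult_neg_pos)
    have "\<phi> x \<le> w \<tau> * ((1 + 2 * residual R \<tau>) * (w \<tau> * \<phi> y))"
      by (rule order_trans[OF near(1) mult_left_mono[OF order_trans[OF ratio_leD[OF ratio, of x y]
        mult_left_mono[OF near(2) c]] w0]])
    also have "\<dots> = w \<tau> * (w \<tau> * (1 + 2 * residual R \<tau>)) * \<phi> y" by simp
    also have "\<dots> \<le> (1 + \<epsilon>) * \<phi> y" using small pos(1)[of y] by (intro mult_right_mono) auto
    finally show "\<phi> x \<le> (1 + \<epsilon>) * \<phi> y" .
  qed
  show ?thesis
    using eventually_in_late_window[OF \<tau>(1), of i0]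
  proof eventually_elim
    case (elim t)
    then obtain i where i: "i0 \<le> i" "t \<in> window \<tau> i" by blast
    have g: "good_window R t0 \<tau> i" using i0 i by blast
    note g' = good_window_swap[OF g]
    have t: "t \<in> {win \<tau> i..win \<tau> (Suc i)}" using i by simp
    have pos: "0 < win \<tau> i" "0 < t" using g i by (auto simp: good_window_def balanced_def)
    have "ratio_le \<epsilon> (p t)"
      using window_drift(1,2)[OF g t] i0[OF i(1)] pos
      by (intro transfer[of "p t" "p (win \<tau> i)"]) (auto simp: w_def intro: p_pos)
    moreover have "ratio_le \<epsilon> (q t)"
      using sw.window_drift(1,2)[OF g' t] i0[OF i(1)] pos
      by (intro transfer[of "q t" "q (win \<tau> i)"]) (auto simp: w_def intro: q_pos)
    ultimately show ?case by blast
  qed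
qed

end

section \<open>A uniform law of large numbers along windows\<close>

text \<open>The sum of all squares has a finite expectation, so almost surely it converges.\<close>

lemma (in prob_space) AE_tendsto_0_if_second_moments_summable:
  fixes Z :: "nat \<Rightarrow> 'a \<Rightarrow> real"
  assumes [measurable]: "\<And>k. Z k \<in> borel_measurable M"
    and int: "\<And>k. integrable M (\<lambda>\<omega>. (Z k \<omega>)\<^sup>2)"
    and bound: "\<And>N. (\<Sum>k<N. expectation (\<lambda>\<omega>. (Z k \<omega>)\<^sup>2)) \<le> c"
  shows "AE \<omega> in M. (\<lambda>k. Z k \<omega>) \<longlonglongrightarrow> 0"
proof -
  have "(\<integral>\<^sup>+\<omega>. (\<Sum>k. ennreal ((Z k \<omega>)\<^sup>2)) \<partial>M) = (\<Sum>k. \<integral>\<^sup>+\<omega>. ennreal ((Z k \<omega>)\<^sup>2) \<partial>M)"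
    by (intro nn_integral_suminf) auto
  also have "\<dots> = (\<Sum>k. ennreal (expectation (\<lambda>\<omega>. (Z k \<omega>)\<^sup>2)))"
    by (simp add: nn_integral_eq_integral int)
  also have "\<dots> \<le> ennreal c"
  proof (rule suminf_le_const)
    show "(\<Sum>k<N. ennreal (expectation (\<lambda>\<omega>. (Z k \<omega>)\<^sup>2))) \<le> ennreal c" for N
      using bound[of N] by (subst sum_ennreal) (auto intro: ennreal_leI)
  qed auto
  finally have "(\<integral>\<^sup>+\<omega>. (\<Sum>k. ennreal ((Z k \<omega>)\<^sup>2)) \<partial>M) \<noteq> \<infinity>"
    by (auto simp: top_unique)
  then have "AE \<omega> in M. (\<Sum>k. ennreal ((Z k \<omega>)\<^sup>2)) \<noteq> \<infinity>"
    by (intro nn_integral_PInf_AE) auto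
  then show ?thesis
  proof eventually_elim
    case (elim \<omega>)
    then have "summable (\<lambda>k. (Z k \<omega>)\<^sup>2)"
      by (intro summable_suminf_not_top) auto
    then have "(\<lambda>k. (Z k \<omega>)\<^sup>2) \<longlonglongrightarrow> 0" by (rule summable_LIMSEQ_zero)
    then show ?case by simp
  qed
qed

lemma (in prob_space) expectation_square_sum_uncorrelated:
  fixes V :: "nat \<Rightarrow> 'a \<Rightarrow> real"
  assumes "finite S" "\<And>s t. integrable M (\<lambda>\<omega>. V s \<omega> * V t \<omega>)"
    and "\<And>s t. s \<noteq> t \<Longrightarrow> expectation (\<lambda>\<omega>. V s \<omega> * V t \<omega>) = 0"
  shows "expectation (\<lambda>\<omega>. (\<Sum>s\<in>S. c s * V s \<omega>)\<^sup>2) = (\<Sum>s\<in>S. (c s)\<^sup>2 * expectation (\<lambda>\<omega>. (V s \<omega>)\<^sup>2))"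
proof -
  have "expectation (\<lambda>\<omega>. (\<Sum>s\<in>S. c s * V s \<omega>)\<^sup>2)
      = expectation (\<lambda>\<omega>. \<Sum>s\<in>S. \<Sum>t\<in>S. (c s * c t) * (V s \<omega> * V t \<omega>))"
    by (intro Bochner_Integration.integral_cong refl) (simp add: power2_eq_square sum_product mult_ac)
  also have "\<dots> = (\<Sum>s\<in>S. \<Sum>t\<in>S. (c s * c t) * expectation (\<lambda>\<omega>. V s \<omega> * V t \<omega>))"
    using assms(2) by (simp add: Bochner_Integration.integral_sum)
  also have "\<dots> = (\<Sum>s\<in>S. (c s)\<^sup>2 * expectation (\<lambda>\<omega>. (V s \<omega>)\<^sup>2))"
  proof (intro sum.cong refl)
    fix s assume "s \<in> S"
    then show "(\<Sum>t\<in>S. (c s * c t) * expectation (\<lambda>\<omega>. V s \<omega> * V t \<omega>)) = (c s)\<^sup>2 * expectation (\<lambda>\<omega>. (V s \<omega>)\<^sup>2)"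
      using assms by (subst sum.remove[of _ s]) (auto simp: power2_eq_square intro!: sum.neutral)
  qed
  finally show ?thesis .
qed

text \<open>The sets are indexed by all natural numbers to avoid side conditions; those with an index of at least
\<open>N\<close> are redundant. That the others partition the space is expressed by their indicators, which is
how the partition is used.\<close>

lemma finite_borel_partition:
  assumes "compact (UNIV :: 'a::metric_space set)" "0 < d"
  shows "\<exists>N (B :: nat \<Rightarrow> 'a set) c. \<forall>l. B l \<in> sets borel \<and> (\<forall>z\<in>B l. l < N \<longrightarrow> dist z (c l) < d)
    \<and> (\<forall>z. (\<Sum>l<N. indicator (B l) z) = (1::real))"
proof -
  obtain S :: "'a set" where S: "finite S" "UNIV \<subseteq> (\<Union>z\<in>S. ball z d)"
    using seq_compact_imp_totally_bounded[of "UNIV :: 'a set"] assms by (metis compact_imp_seq_compact)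
  obtain c where c: "bij_betw c {0..<card S} S" using ex_bij_betw_nat_finite[OF S(1)] by blast
  define B where "B = disjointed (\<lambda>l. ball (c l) d)"
  have "B l \<in> sets borel" for l
    unfolding B_def disjointed_def by (intro sets.Diff sets.finite_UN) auto
  moreover have "dist z (c l) < d" if "z \<in> B l" for z l
    using that disjointed_subset[of "\<lambda>l. ball (c l) d" l] by (auto simp: B_def dist_commute)
  moreover have "(\<Sum>l<card S. indicator (B l) z) = (1::real)" for z
  proof -
    have "disjoint_family_on B {..<card S}"
      unfolding B_def by (rule disjoint_family_on_mono[OF _ disjoint_family_disjointed]) simp
    then have "(\<Sum>l<card S. indicator (B l) z :: real) = indicator (\<Union>l<card S. B l) z"
      by (intro indicator_UN_disjoint[symmetric]) auto
    also have "(\<Union>l<card S. B l) = UNIV"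
    proof -
      have "(\<Union>l<card S. B l) = (\<Union>l\<in>{0..<card S}. ball (c l) d)"
        using finite_UN_disjointed_eq[of "\<lambda>l. ball (c l) d" "card S"] by (simp add: B_def lessThan_atLeast0)
      also have "\<dots> = (\<Union>z\<in>c ` {0..<card S}. ball z d)" by simp
      also have "\<dots> = UNIV" using S(2) c by (auto simp: bij_betw_def)
      finally show ?thesis .
    qed
    finally show ?thesis by simp
  qed
  ultimately show ?thesis by blast
qed

lemma step_function_approximation:
  assumes part: "\<And>z l. z \<in> B l \<Longrightarrow> l < N \<Longrightarrow> dist z (c l) < d" "\<And>z. (\<Sum>l<N. indicator (B l) z) = (1::real)"
    and \<phi>: "log_lipschitz K \<phi>" "0 \<le> K" "\<And>z. \<phi> z \<le> 1"
  shows "\<bar>\<phi> z - (\<Sum>l<N. \<phi> (c l) * indicator (B l) z)\<bar> \<le> exp (K * d) - 1"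
proof -
  have close: "\<bar>\<phi> z - \<phi> (c l)\<bar> \<le> exp (K * d) - 1" if "z \<in> B l" "l < N" for l
  proof -
    have *: "\<phi> u - \<phi> v \<le> exp (K * d) - 1" if "dist u v < d" for u v
    proof -
      have "\<phi> u \<le> exp (K * d) * \<phi> v" using \<phi> that by (intro log_lipschitz_le) auto
      moreover have "0 \<le> exp (K * d) - 1"
        using \<phi>(2) le_less_trans[OF zero_le_dist that] by simp
      then have "(exp (K * d) - 1) * \<phi> v \<le> (exp (K * d) - 1) * 1" using \<phi>(3) by (intro mult_left_mono)
      ultimately show ?thesis by (simp add: left_diff_distrib)
    qed
    show ?thesis using *[of z "c l"] *[of "c l" z] part(1)[OF that] by (simp add: abs_le_iff dist_commute)
  qed
  have "(\<Sum>l<N. indicator (B l) z * \<phi> z) = \<phi> z"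
    unfolding sum_distrib_right[symmetric] part(2) by simp
  then have "\<phi> z - (\<Sum>l<N. \<phi> (c l) * indicator (B l) z) = (\<Sum>l<N. indicator (B l) z * (\<phi> z - \<phi> (c l)))"
    unfolding right_diff_distrib sum_subtractf by (simp add: mult.commute)
  also have "\<bar>\<dots>\<bar> \<le> (\<Sum>l<N. indicator (B l) z * (exp (K * d) - 1))"
    by (rule order_trans[OF sum_abs]) (intro sum_mono, auto simp: abs_mult indicator_def close)
  also have "\<dots> = exp (K * d) - 1" unfolding sum_distrib_right[symmetric] part(2) by simp
  finally show ?thesis .
qed

text \<open>Replacing a test function by a step function on a fine partition reduces its sampling error to the errors
of the frequencies of finitely many sets, with an error that depends only on the modulus of continuity.
This is what makes the law of large numbers uniform over test functions.\<close>

lemma mean_error_by_frequencies: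
  fixes \<phi> :: "'a::metric_space \<Rightarrow> real"
  assumes compact: "compact (UNIV :: 'a set)" and \<mu>: "prob_space \<mu>" "sets \<mu> = sets borel"
    and I: "finite I" "I \<noteq> {}"
    and part: "\<And>l. B l \<in> sets borel" "\<And>z l. z \<in> B l \<Longrightarrow> l < N \<Longrightarrow> dist z (c l) < d"
      "\<And>z. (\<Sum>l<N. indicator (B l) z) = (1::real)"
    and \<phi>: "log_lipschitz K \<phi>" "0 \<le> K" "\<And>z. \<phi> z \<le> 1"
  shows "\<bar>(batch_mean x I \<phi> - (LINT z|\<mu>. \<phi> z))
      - (\<Sum>l<N. \<phi> (c l) * (batch_mean x I (indicator (B l)) - measure \<mu> (B l)))\<bar> \<le> 2 * (exp (K * d) - 1)"
proof -
  interpret prob_space \<mu> by fact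
  define \<psi> where "\<psi> z = (\<Sum>l<N. \<phi> (c l) * indicator (B l) z)" for z
  define w where "w = exp (K * d) - 1"
  have close: "\<bar>\<phi> z - \<psi> z\<bar> \<le> w" for z
    unfolding \<psi>_def w_def by (rule step_function_approximation[OF part(2,3) \<phi>])
  have B: "B l \<in> sets \<mu>" for l using part(1) \<mu>(2) by simp
  have int: "integrable \<mu> \<phi>"
    by (rule integrable_continuous_compact[OF compact \<mu> log_lipschitz_continuous[OF \<phi>(1,2)]])
  have int_ind: "integrable \<mu> (\<lambda>z. \<phi> (c l) * indicator (B l) z)" for l
    using B by (auto simp: emeasure_eq_measure intro!: integrable_mult_right integrable_real_indicator)
  then have int': "integrable \<mu> \<psi>" unfolding \<psi>_def by (intro Bochner_Integration.integrable_sum)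
  have m: "batch_mean x I \<psi> = (\<Sum>l<N. \<phi> (c l) * batch_mean x I (indicator (B l)))"
  proof -
    have "(\<Sum>i\<in>I. \<psi> (x i)) = (\<Sum>l<N. \<Sum>i\<in>I. \<phi> (c l) * indicator (B l) (x i))"
      unfolding \<psi>_def by (rule sum.swap)
    then show ?thesis by (simp add: batch_mean_def sum_divide_distrib sum_distrib_left)
  qed
  have "(LINT z|\<mu>. \<psi> z) = (\<Sum>l<N. \<phi> (c l) * measure \<mu> (B l))"
    unfolding \<psi>_def using sets.sets_into_space[OF B]
    by (subst Bochner_Integration.integral_sum[OF int_ind]) (simp add: Int_absorb2)
  with m have eq: "(batch_mean x I \<phi> - (LINT z|\<mu>. \<phi> z))
      - (\<Sum>l<N. \<phi> (c l) * (batch_mean x I (indicator (B l)) - measure \<mu> (B l)))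
    = batch_mean x I (\<lambda>z. \<phi> z - \<psi> z) - (LINT z|\<mu>. \<phi> z - \<psi> z)"
    using int int' by (simp add: batch_mean_diff right_diff_distrib sum_subtractf)
  have 1: "\<bar>batch_mean x I (\<lambda>z. \<phi> z - \<psi> z)\<bar> \<le> w"
    using batch_mean_abs_le[of "\<lambda>z. \<phi> z - \<psi> z" "\<lambda>_. w" x I] close I by (simp add: batch_mean_const)
  have 2: "\<bar>LINT z|\<mu>. \<phi> z - \<psi> z\<bar> \<le> w"
  proof -
    have "\<bar>LINT z|\<mu>. \<phi> z - \<psi> z\<bar> \<le> (LINT z|\<mu>. \<bar>\<phi> z - \<psi> z\<bar>)" by (rule integral_abs_bound)
    also have "\<dots> \<le> (LINT z|\<mu>. w)"
      using int int' close by (intro integral_mono) auto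
    finally show ?thesis by (simp add: prob_space)
  qed
  show ?thesis unfolding eq w_def[symmetric] using 1 2 by linarith
qed

text \<open>Distinct batches use disjoint sets of independent samples.\<close>

lemma (in prob_space) batch_frequencies_uncorrelated:
  fixes X :: "nat \<Rightarrow> 'a \<Rightarrow> 'b::metric_space"
  assumes indep: "indep_vars (\<lambda>_. borel) X {1..}" and distr: "\<And>i. 1 \<le> i \<Longrightarrow> distr M borel (X i) = \<mu>"
    and B: "B \<in> sets borel" and I: "\<And>s. I s \<subseteq> {1..}" "\<And>s t. s \<noteq> t \<Longrightarrow> I s \<inter> I t = {}"
  defines "V \<equiv> \<lambda>s \<omega>. batch_mean (\<lambda>i. X i \<omega>) (I s) (\<lambda>z. indicator B z - measure \<mu> B)"
  assumes "s \<noteq> t"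
  shows "expectation (\<lambda>\<omega>. V s \<omega> * V t \<omega>) = 0"
proof -
  define D where "D i \<omega> = indicator B (X i \<omega>) - measure \<mu> B" for i \<omega>
  have meas: "X i \<in> measurable M borel" if "1 \<le> i" for i
    using indep that by (auto simp: indep_vars_def)
  have B': "(\<lambda>z. indicator B z - measure \<mu> B) \<in> borel_measurable borel" using B by measurable
  have mean: "expectation (D i) = 0" and intD: "integrable M (D i)" if "1 \<le> i" for i
  proof -
    have ind: "expectation (\<lambda>\<omega>. indicator B (X i \<omega>)) = measure \<mu> B" "integrable M (\<lambda>\<omega>. indicator B (X i \<omega>) :: real)"
    proof -
      note [measurable] = meas[OF that] B
      interpret d: prob_space "distr M borel (X i)" by (intro prob_space_distr meas that)
      have "expectation (\<lambda>\<omega>. indicator B (X i \<omega>) :: real) = (LINT z|distr M borel (X i). indicator B z)"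
        by (subst integral_distr) auto
      then show "expectation (\<lambda>\<omega>. indicator B (X i \<omega>)) = measure \<mu> B" using distr[OF that] B by auto
      show "integrable M (\<lambda>\<omega>. indicator B (X i \<omega>) :: real)"
        by (intro integrable_const_bound[where B = 1]) auto
    qed
    then show "expectation (D i) = 0" "integrable M (D i)"
      unfolding D_def by (simp_all add: prob_space)
  qed
  have indepD: "indep_vars (\<lambda>_. borel) D {1..}"
    unfolding D_def by (rule indep_vars_compose2[OF indep]) (rule B')
  have DD: "expectation (\<lambda>\<omega>. D i \<omega> * D j \<omega>) = 0 \<and> integrable M (\<lambda>\<omega>. D i \<omega> * D j \<omega>)"
    if "1 \<le> i" "1 \<le> j" "i \<noteq> j" for i j
  proof -
    have *: "indep_vars (\<lambda>_. borel) D {i, j}" using that by (intro indep_vars_subset[OF indepD]) auto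
    have **: "integrable M (D l)" if "l \<in> {i, j}" for l using that \<open>1 \<le> i\<close> \<open>1 \<le> j\<close> intD by auto
    show ?thesis
      using indep_vars_lebesgue_integral[OF _ * **] indep_vars_integrable[OF _ * **] that mean by simp
  qed
  have V: "V s \<omega> = (\<Sum>i\<in>I s. D i \<omega>) / card (I s)" for s \<omega> by (simp add: V_def batch_mean_def D_def)
  have st: "expectation (\<lambda>\<omega>. D i \<omega> * D j \<omega>) = 0" "integrable M (\<lambda>\<omega>. D i \<omega> * D j \<omega>)"
    if "i \<in> I s" "j \<in> I t" for i j
  proof -
    have "1 \<le> i" "1 \<le> j" "i \<noteq> j" using that I(1)[of s] I(1)[of t] I(2)[OF \<open>s \<noteq> t\<close>] by auto
    then show "expectation (\<lambda>\<omega>. D i \<omega> * D j \<omega>) = 0" "integrable M (\<lambda>\<omega>. D i \<omega> * D j \<omega>)"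
      using DD by auto
  qed
  have "expectation (\<lambda>\<omega>. V s \<omega> * V t \<omega>)
      = expectation (\<lambda>\<omega>. (\<Sum>i\<in>I s. \<Sum>j\<in>I t. D i \<omega> * D j \<omega>)) / (card (I s) * card (I t))"
    unfolding V by (simp add: sum_product)
  also have "expectation (\<lambda>\<omega>. (\<Sum>i\<in>I s. \<Sum>j\<in>I t. D i \<omega> * D j \<omega>))
      = (\<Sum>i\<in>I s. expectation (\<lambda>\<omega>. \<Sum>j\<in>I t. D i \<omega> * D j \<omega>))"
    by (intro Bochner_Integration.integral_sum Bochner_Integration.integrable_sum st(2))
  also have "\<dots> = (\<Sum>i\<in>I s. \<Sum>j\<in>I t. expectation (\<lambda>\<omega>. D i \<omega> * D j \<omega>))"
    by (intro sum.cong refl Bochner_Integration.integral_sum st(2))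
  also have "\<dots> = 0"
    by (intro sum.neutral ballI st(1))
  finally show ?thesis by simp
qed

context step_sizes begin

text \<open>The errors of the frequencies in distinct batches are uncorrelated and at most 1, so over one window the
second moment of their weighted sum is at most the sum of the squares of the weights. Since windows are
disjoint, these moments are summable. Looking only at whole windows avoids any maximal inequality.\<close>

lemma AE_window_frequency:
  fixes X :: "nat \<Rightarrow> 'w \<Rightarrow> 'b::metric_space"
  assumes M: "prob_space M" and indep: "prob_space.indep_vars M (\<lambda>_. borel) X {1..}"
    and distr: "\<And>i. 1 \<le> i \<Longrightarrow> distr M borel (X i) = \<mu>"
    and I: "\<And>s. I s \<subseteq> {1..}" "\<And>s t. s \<noteq> t \<Longrightarrow> I s \<inter> I t = {}" "\<And>s. finite (I s)" "\<And>s. I s \<noteq> {}"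
    and B: "B \<in> sets borel" and \<tau>: "0 < \<tau>"
  shows "AE \<omega> in M. (\<lambda>k. \<Sum>s\<in>window \<tau> k. \<eta> s * (batch_mean (\<lambda>i. X i \<omega>) (I s) (indicator B) - measure \<mu> B)) \<longlonglongrightarrow> 0"
proof -
  interpret prob_space M by fact
  have meas: "X i \<in> measurable M borel" if "1 \<le> i" for i
    using indep that by (auto simp: indep_vars_def)
  interpret \<mu>: prob_space \<mu> using prob_space_distr[OF meas[of 1]] distr[of 1] by simp
  define V where "V s \<omega> = batch_mean (\<lambda>i. X i \<omega>) (I s) (\<lambda>z. indicator B z - measure \<mu> B)" for s \<omega>
  have V_eq: "V s \<omega> = batch_mean (\<lambda>i. X i \<omega>) (I s) (indicator B) - measure \<mu> B" for s \<omega>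
    using I by (simp add: V_def batch_mean_diff batch_mean_const)
  have V_le: "\<bar>V s \<omega>\<bar> \<le> 1" for s \<omega>
  proof -
    have "\<bar>indicator B z - measure \<mu> B\<bar> \<le> 1" for z
      using \<mu>.prob_le_1[of B] measure_nonneg[of \<mu> B] by (auto simp: indicator_def simp del: \<mu>.prob_le_1)
    then show ?thesis unfolding V_def
      using batch_mean_abs_le[of "\<lambda>z. indicator B z - measure \<mu> B" "\<lambda>_. 1" "\<lambda>i. X i \<omega>" "I s"] I
      by (simp add: batch_mean_const)
  qed
  have V_meas[measurable]: "V s \<in> borel_measurable M" for s
  proof -
    have "(\<lambda>\<omega>. indicator B (X i \<omega>) - measure \<mu> B) \<in> borel_measurable M" if "i \<in> I s" for i
    proof -
      have "1 \<le> i" using I(1)[of s] that by auto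
      note [measurable] = meas[OF this] B
      show ?thesis by measurable
    qed
    then show ?thesis unfolding V_def[abs_def] batch_mean_def
      by (intro borel_measurable_divide borel_measurable_sum) auto
  qed
  have int2: "integrable M (\<lambda>\<omega>. V s \<omega> * V t \<omega>)" for s t
    using mult_mono[OF V_le V_le] by (intro integrable_const_bound[where B = 1]) (auto simp: abs_mult)
  define Z where "Z k \<omega> = (\<Sum>s\<in>window \<tau> k. \<eta> s * V s \<omega>)" for k \<omega>
  have intZ: "integrable M (\<lambda>\<omega>. (Z k \<omega>)\<^sup>2)" for k
  proof -
    have "(\<lambda>\<omega>. (Z k \<omega>)\<^sup>2) = (\<lambda>\<omega>. \<Sum>s\<in>window \<tau> k. \<Sum>t\<in>window \<tau> k. (\<eta> s * \<eta> t) * (V s \<omega> * V t \<omega>))"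
      by (simp add: Z_def power2_eq_square sum_product mult_ac)
    then show ?thesis using int2 by simp
  qed
  have "expectation (\<lambda>\<omega>. (Z k \<omega>)\<^sup>2) \<le> (\<Sum>s\<in>window \<tau> k. (\<eta> s)\<^sup>2)" for k
  proof -
    have "expectation (\<lambda>\<omega>. (Z k \<omega>)\<^sup>2) = (\<Sum>s\<in>window \<tau> k. (\<eta> s)\<^sup>2 * expectation (\<lambda>\<omega>. (V s \<omega>)\<^sup>2))"
      unfolding Z_def V_def
      by (intro expectation_square_sum_uncorrelated batch_frequencies_uncorrelated[OF indep distr B I(1,2)])
        (auto intro: int2[unfolded V_def])
    also have "\<dots> \<le> (\<Sum>s\<in>window \<tau> k. (\<eta> s)\<^sup>2 * 1)"
    proof (intro sum_mono mult_left_mono)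
      fix s
      have "expectation (\<lambda>\<omega>. (V s \<omega>)\<^sup>2) \<le> expectation (\<lambda>\<omega>. 1)"
        using int2[of s s] V_le by (intro integral_mono) (auto simp: power2_eq_square abs_square_le_1[unfolded power2_eq_square])
      then show "expectation (\<lambda>\<omega>. (V s \<omega>)\<^sup>2) \<le> 1" by (simp add: prob_space)
    qed simp
    finally show ?thesis by simp
  qed
  then have "(\<Sum>k<N. expectation (\<lambda>\<omega>. (Z k \<omega>)\<^sup>2)) \<le> (\<Sum>s. (\<eta> s)\<^sup>2)" for N
    by (rule order_trans[OF sum_mono sum_windows_square[OF \<tau>]])
  moreover have "Z k \<in> borel_measurable M" for k unfolding Z_def[abs_def] by measurable
  ultimately have "AE \<omega> in M. (\<lambda>k. Z k \<omega>) \<longlonglongrightarrow> 0"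
    using intZ by (intro AE_tendsto_0_if_second_moments_summable)
  then show ?thesis by (simp add: Z_def V_eq)
qed

text \<open>Almost surely the frequencies of all sets of countably many finite partitions, of mesh tending to 0, behave
as in \<open>AE_window_frequency\<close>. The mesh is chosen first, so that the discretisation error is at most
\<open>\<epsilon> / 2\<close>; then only finitely many sets remain.\<close>

proposition AE_equidistributed:
  fixes X :: "nat \<Rightarrow> 'w \<Rightarrow> 'b::metric_space"
  assumes compact: "compact (UNIV :: 'b set)"
    and M: "prob_space M" and indep: "prob_space.indep_vars M (\<lambda>_. borel) X {1..}"
    and distr: "\<And>i. 1 \<le> i \<Longrightarrow> distr M borel (X i) = \<mu>"
    and I: "\<And>s. I s \<subseteq> {1..}" "\<And>s t. s \<noteq> t \<Longrightarrow> I s \<inter> I t = {}" "\<And>s. finite (I s)" "\<And>s. I s \<noteq> {}"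
    and K: "0 \<le> K"
  shows "AE \<omega> in M. equidistributed K I (\<lambda>i. X i \<omega>) \<mu>"
proof -
  interpret prob_space M by fact
  have "X 1 \<in> measurable M borel" using indep by (auto simp: indep_vars_def)
  then have \<mu>: "prob_space \<mu>" "sets \<mu> = sets borel"
    using prob_space_distr[of "X 1" borel] distr[of 1] by auto
  define part where "part m N B c \<longleftrightarrow> (\<forall>l. (B l :: 'b set) \<in> sets borel \<and>
    (\<forall>z\<in>B l. l < N \<longrightarrow> dist z (c l) < 1 / real (Suc m)) \<and> (\<forall>z. (\<Sum>l<N. indicator (B l) z) = (1::real)))"
    for m and N :: nat and B c
  have "\<exists>N B c. part m N B c" for m
    unfolding part_def by (rule finite_borel_partition[OF compact]) simp
  then obtain N B c where "part m (N m) (B m) (c m)" for m by metis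
  then have part: "B m l \<in> sets borel" "z \<in> B m l \<Longrightarrow> l < N m \<Longrightarrow> dist z (c m l) < 1 / real (Suc m)"
    "(\<Sum>l<N m. indicator (B m l) z) = (1::real)" for m l z
    unfolding part_def by blast+
  define Z where "Z j m l k \<omega> = (\<Sum>s\<in>window (1 / real (Suc j)) k.
    \<eta> s * (batch_mean (\<lambda>i. X i \<omega>) (I s) (indicator (B m l)) - measure \<mu> (B m l)))" for j m l k \<omega>
  have "AE \<omega> in M. \<forall>j m l. (\<lambda>k. Z j m l k \<omega>) \<longlonglongrightarrow> 0"
    unfolding AE_all_countable Z_def
    by (intro allI AE_window_frequency[OF M indep distr I] part) auto
  then show ?thesis
  proof eventually_elim
    case (elim \<omega>)
    show ?case unfolding equidistributed_def
    proof (intro allI impI)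
      fix j :: nat and \<epsilon> :: real
      assume \<epsilon>: "0 < \<epsilon>"
      define \<tau> where "\<tau> = 1 / real (Suc j)"
      have \<tau>: "0 < \<tau>" by (simp add: \<tau>_def)
      have "(\<lambda>m. 4 * \<tau> * (exp (K * (1 / real (Suc m))) - 1)) \<longlonglongrightarrow> 4 * \<tau> * (exp (K * 0) - 1)"
        using LIMSEQ_inverse_real_of_nat by (intro tendsto_intros) (simp add: inverse_eq_divide)
      then have "\<forall>\<^sub>F m in sequentially. 4 * \<tau> * (exp (K * (1 / real (Suc m))) - 1) < \<epsilon> / 2"
        using \<epsilon> by (intro order_tendstoD) auto
      then obtain m where m: "4 * \<tau> * (exp (K * (1 / real (Suc m))) - 1) < \<epsilon> / 2"
        by (auto simp: eventually_sequentially)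
      define w where "w = exp (K * (1 / real (Suc m))) - 1"
      have w0: "0 \<le> w" using K by (simp add: w_def)
      have "(\<lambda>k. \<Sum>l<N m. \<bar>Z j m l k \<omega>\<bar>) \<longlonglongrightarrow> (\<Sum>l<N m. \<bar>0\<bar>)"
        using elim by (intro tendsto_intros) auto
      then have "\<forall>\<^sub>F k in sequentially. (\<Sum>l<N m. \<bar>Z j m l k \<omega>\<bar>) < \<epsilon> / 2"
        using \<epsilon> by (intro order_tendstoD) auto
      then show "\<forall>\<^sub>F k in sequentially. \<forall>\<phi>. log_lipschitz K \<phi> \<longrightarrow> (\<forall>z. \<phi> z \<le> 1) \<longrightarrow>
        \<bar>\<Sum>s\<in>window (1 / real (Suc j)) k. \<eta> s * (batch_mean (\<lambda>i. X i \<omega>) (I s) \<phi> - (LINT z|\<mu>. \<phi> z))\<bar> \<le> \<epsilon>"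
        using eventually_window_length[OF \<tau>] eventually_win_ge[OF \<tau>, of 1]
      proof eventually_elim
        case (elim k)
        show ?case
        proof (intro allI impI)
          fix \<phi> :: "'b \<Rightarrow> real"
          assume \<phi>: "log_lipschitz K \<phi>" "\<forall>z. \<phi> z \<le> 1"
          define e where "e s = batch_mean (\<lambda>i. X i \<omega>) (I s) \<phi> - (LINT z|\<mu>. \<phi> z)" for s
          define f where "f s = (\<Sum>l<N m. \<phi> (c m l) *
            (batch_mean (\<lambda>i. X i \<omega>) (I s) (indicator (B m l)) - measure \<mu> (B m l)))" for s
          have ef: "\<bar>e s - f s\<bar> \<le> 2 * w" for s
            unfolding e_def f_def w_def using \<phi>
            by (intro mean_error_by_frequencies[OF compact \<mu> I(3,4) part] K) auto
          have "\<bar>\<Sum>s\<in>window \<tau> k. \<eta> s * (e s - f s)\<bar> \<le> (\<Sum>s\<in>window \<tau> k. \<eta> s * (2 * w))"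
            using elim by (intro order_trans[OF sum_abs] sum_mono)
              (auto simp: abs_mult \<eta>_nonneg intro!: mult_left_mono ef)
          also have "\<dots> = sum \<eta> (window \<tau> k) * (2 * w)" by (simp add: sum_distrib_right)
          also have "\<dots> \<le> (2 * \<tau>) * (2 * w)" using elim w0 by (intro mult_right_mono) auto
          also have "\<dots> \<le> \<epsilon> / 2" using m[folded w_def] by simp
          finally have 1: "\<bar>\<Sum>s\<in>window \<tau> k. \<eta> s * (e s - f s)\<bar> \<le> \<epsilon> / 2" .
          have "(\<Sum>s\<in>window \<tau> k. \<eta> s * f s) = (\<Sum>l<N m. \<phi> (c m l) * Z j m l k \<omega>)"
            unfolding f_def Z_def \<tau>_def sum_distrib_left
            by (subst sum.swap) (simp add: mult_ac)
          also have "\<bar>\<dots>\<bar> \<le> (\<Sum>l<N m. \<bar>Z j m l k \<omega>\<bar>)"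
          proof (intro order_trans[OF sum_abs] sum_mono)
            fix l
            have "\<bar>\<phi> (c m l)\<bar> \<le> 1" using \<phi>(2) log_lipschitz_pos[OF \<phi>(1), of "c m l"] by simp
            then show "\<bar>\<phi> (c m l) * Z j m l k \<omega>\<bar> \<le> \<bar>Z j m l k \<omega>\<bar>"
              by (simp add: abs_mult mult_left_le_one_le)
          qed
          finally have 2: "\<bar>\<Sum>s\<in>window \<tau> k. \<eta> s * f s\<bar> \<le> \<epsilon> / 2" using elim by linarith
          have "(\<Sum>s\<in>window \<tau> k. \<eta> s * e s) = (\<Sum>s\<in>window \<tau> k. \<eta> s * (e s - f s)) + (\<Sum>s\<in>window \<tau> k. \<eta> s * f s)"
            by (simp add: right_diff_distrib sum_subtractf)
          then have "\<bar>\<Sum>s\<in>window \<tau> k. \<eta> s * e s\<bar> \<le> \<epsilon>" using 1 2 by linarith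
          then show "\<bar>\<Sum>s\<in>window (1 / real (Suc j)) k. \<eta> s * (batch_mean (\<lambda>i. X i \<omega>) (I s) \<phi> - (LINT z|\<mu>. \<phi> z))\<bar> \<le> \<epsilon>"
            unfolding e_def \<tau>_def .
        qed
      qed
    qed
  qed
qed

end

section \<open>Sinkhorn iterates as averaged dynamics\<close>

lemma var_norm_le:
  assumes "\<And>x y. exp (- h x) \<le> exp c * exp (- h y)"
  shows "var_norm h \<le> c"
proof -
  have d: "h y - h x \<le> c" for x y
    using assms[of x y] by (simp flip: exp_add)
  have "(SUP x. h x) - c \<le> h y" for y
  proof -
    have "(SUP x. h x) \<le> h y + c" using d by (intro cSUP_least) (auto simp: algebra_simps)
    then show ?thesis by simp
  qed
  then have "(SUP x. h x) - c \<le> (INF y. h y)" by (intro cINF_greatest) auto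
  then show ?thesis by (simp add: var_norm_def)
qed

lemma log_lipschitz_integral:
  fixes \<phi> :: "'b::metric_space \<Rightarrow> 'a::metric_space \<Rightarrow> real"
  assumes compact: "compact (UNIV :: 'a set)" and \<mu>: "prob_space \<mu>" "sets \<mu> = sets borel"
    and cont: "\<And>x. continuous_on UNIV (\<phi> x)" and lip: "\<And>y. log_lipschitz K (\<lambda>x. \<phi> x y)"
  shows "log_lipschitz K (\<lambda>x. LINT y|\<mu>. \<phi> x y)"
proof (rule log_lipschitzI)
  interpret prob_space \<mu> by fact
  note int = integrable_continuous_compact[OF compact \<mu>]
  show "0 < (LINT y|\<mu>. \<phi> x y)" for x
  proof -
    obtain y0 where "\<And>y. \<phi> x y0 \<le> \<phi> x y"
      using continuous_attains_inf[OF compact _ cont] by auto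
    then have "(LINT y|\<mu>. \<phi> x y0) \<le> (LINT y|\<mu>. \<phi> x y)"
      by (intro integral_mono int cont continuous_intros)
    then show ?thesis using log_lipschitz_pos[OF lip, of x y0] by (simp add: prob_space)
  qed
  show "(LINT y|\<mu>. \<phi> x y) \<le> exp (K * dist x x') * (LINT y|\<mu>. \<phi> x' y)" for x x'
  proof -
    have "(LINT y|\<mu>. \<phi> x y) \<le> (LINT y|\<mu>. exp (K * dist x x') * \<phi> x' y)"
      by (intro integral_mono int cont continuous_intros log_lipschitzD[OF lip])
    then show ?thesis by simp
  qed
qed

text \<open>Applied to the optimal potentials, the first part gives their regularity, and the second the normalisation
of the kernel \<open>k\<close>.\<close>

lemma exp_soft_C_transform:
  fixes C :: "'a::metric_space \<Rightarrow> 'a \<Rightarrow> real"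
  assumes compact: "compact (UNIV :: 'a set)" and \<mu>: "prob_space \<mu>" "sets \<mu> = sets borel"
    and C: "\<And>x. L-lipschitz_on UNIV (C x)" "\<And>y. L-lipschitz_on UNIV (\<lambda>x. C x y)"
    and h: "continuous_on UNIV h"
  shows "log_lipschitz L (\<lambda>x. exp (soft_C_transform C \<mu> h x))"
    and "(LINT y|\<mu>. exp (soft_C_transform C \<mu> h x + h y - C x y)) = 1"
proof -
  define J where "J x = (LINT y|\<mu>. exp (h y - C x y))" for x
  have C_cont: "continuous_on UNIV (C x)" for x by (rule lipschitz_on_continuous_on[OF C(1)])
  have J: "log_lipschitz L J" unfolding J_def
  proof (rule log_lipschitz_integral[OF compact \<mu>])
    show "continuous_on UNIV (\<lambda>y. exp (h y - C x y))" for x by (intro continuous_intros h C_cont)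
    show "log_lipschitz L (\<lambda>x. exp (h y - C x y))" for y
    proof (rule log_lipschitz_exp, rule lipschitz_onI)
      show "dist (h y - C x y) (h y - C x' y) \<le> L * dist x x'" for x x'
        using lipschitz_onD[OF C(2), of x x' y] by (simp add: dist_real_def abs_minus_commute)
    qed (rule lipschitz_on_nonneg[OF C(1)])
  qed
  have eq: "exp (soft_C_transform C \<mu> h x) = 1 / J x" for x
    using log_lipschitz_pos[OF J, of x] by (simp add: soft_C_transform_def J_def exp_minus inverse_eq_divide)
  show "log_lipschitz L (\<lambda>x. exp (soft_C_transform C \<mu> h x))"
    unfolding eq by (rule log_lipschitz_inverse[OF J])
  have "(LINT y|\<mu>. exp (soft_C_transform C \<mu> h x + h y - C x y))
      = (LINT y|\<mu>. exp (soft_C_transform C \<mu> h x) * exp (h y - C x y))"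
    by (simp add: add_diff_eq flip: exp_add)
  also have "\<dots> = 1 / J x * J x" unfolding eq by (simp add: J_def)
  also have "\<dots> = 1" using log_lipschitz_pos[OF J, of x] by simp
  finally show "(LINT y|\<mu>. exp (soft_C_transform C \<mu> h x + h y - C x y)) = 1" .
qed

lemma soft_C_transform_batch:
  assumes "continuous_on UNIV h" "\<And>z. continuous_on UNIV (C z)" "n > 0"
  shows "exp (- soft_C_transform C (empirical (\<lambda>_. n) x t) h z)
    = batch_mean x (batch (\<lambda>_. n) t) (\<lambda>w. exp (h w - C z w))"
  using soft_C_transform_empirical(2)[where h = h and C = C and b = "\<lambda>_. n" and t = t and x = x and z = z] assms
  by (simp add: batch_mean_def)

text \<open>At every time \<open>exp (- f\<^sub>t)\<close> is a positive combination of functions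
\<open>exp (- C z y\<^sub>i)\<close>.\<close>

lemma sinkhorn_log_lipschitz:
  fixes C :: "'a::metric_space \<Rightarrow> 'a \<Rightarrow> real"
  assumes C: "\<And>x. L-lipschitz_on UNIV (C x)" "\<And>y. L-lipschitz_on UNIV (\<lambda>x. C x y)"
    and \<eta>: "\<And>t. t > 0 \<Longrightarrow> 0 \<le> \<eta> t \<and> \<eta> t \<le> 1" and C_sym: "\<And>x y. C x y = C y x"
    and n: "1 \<le> n" and t: "0 < t"
  shows "log_lipschitz L (\<lambda>z. exp (- sinkhorn_f C \<eta> (\<lambda>_. n) x y t z))
    \<and> log_lipschitz L (\<lambda>z. exp (- sinkhorn_g C \<eta> (\<lambda>_. n) x y t z))"
  using t
proof (induction t)
  case (Suc t)
  have L: "0 \<le> L" by (rule lipschitz_on_nonneg[OF C(1)])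
  have C_cont: "continuous_on UNIV (C z)" for z by (rule lipschitz_on_continuous_on[OF C(1)])
  have summand: "log_lipschitz L (\<lambda>z. exp (c - C z w))" for c w
  proof (rule log_lipschitz_exp, rule lipschitz_onI[OF _ L])
    show "dist (c - C z w) (c - C z' w) \<le> L * dist z z'" for z z'
      using lipschitz_onD[OF C(2), of z z' w] by (simp add: dist_real_def abs_minus_commute)
  qed
  show ?case
  proof (cases "t = 0")
    case True
    have "finite {1..batch_start (\<lambda>_. n) 1}" "{1..batch_start (\<lambda>_. n) 1} \<noteq> {}" using n by auto
    then have "log_lipschitz L (\<lambda>z. \<Sum>i = 1..batch_start (\<lambda>_. n) 1. exp (0 - C z (w i)))" for w
      by (rule log_lipschitz_sum) (rule summand)
    then show ?thesis
      using online_sinkhorn_init[of "\<lambda>_. n" C \<eta> x y] n True unfolding C_sym[of "x _"] by simp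
  next
    case False
    then have t: "0 < t" by simp
    note \<eta>t = \<eta>[OF t, THEN conjunct1] \<eta>[OF t, THEN conjunct2]
    note IH = Suc.IH[OF t]
    have cont: "continuous_on UNIV h" if "log_lipschitz L (\<lambda>z. exp (- h z))" for h :: "'a \<Rightarrow> real"
    proof -
      have "continuous_on UNIV (\<lambda>z. - ln (exp (- h z)))"
        by (intro continuous_intros lipschitz_on_continuous_on[OF log_lipschitz_ln[OF that L]])
      then show ?thesis by simp
    qed
    have mean: "log_lipschitz L (\<lambda>z. exp (- soft_C_transform C (empirical (\<lambda>_. n) w t) h z))"
      if "log_lipschitz L (\<lambda>z. exp (- h z))" for w h
    proof -
      have "log_lipschitz L (\<lambda>z. 1 / real (card (batch (\<lambda>_. n) t)) *
          (\<Sum>i\<in>batch (\<lambda>_. n) t. exp (h (w i) - C z (w i))))"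
        using n by (intro log_lipschitz_scale log_lipschitz_sum summand) auto
      then show ?thesis
        using soft_C_transform_batch[where n = n and x = w and t = t, OF cont[OF that] C_cont] n
        by (simp add: batch_mean_def)
    qed
    note step = online_sinkhorn_step[of t \<eta>, OF t \<eta>t, unfolded Suc_eq_plus1[symmetric]]
    show ?thesis
      unfolding step
      by (intro conjI log_lipschitz_convex[OF _ _ \<eta>t] conjunct1[OF IH] conjunct2[OF IH]
        mean[OF conjunct1[OF IH]] mean[OF conjunct2[OF IH]])
  qed
qed simp

lemma batch_start_const: "batch_start (\<lambda>_. n) t = t * n"
  by (induction t) auto

lemma batches_disjoint:
  assumes "s \<noteq> t"
  shows "batch (\<lambda>_. n) s \<inter> batch (\<lambda>_. n) t = {}"
proof -
  have "batch (\<lambda>_. n) a \<inter> batch (\<lambda>_. n) b = {}" if "a < b" for a b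
  proof -
    have "(a + 1) * n \<le> b * n" using that by (intro mult_right_mono) auto
    then show ?thesis unfolding batch_start_const by auto
  qed
  from this[of s t] this[of t s] show ?thesis using assms by (cases "s < t") (auto simp del: batch_start.simps)
qed

theorem proposition2:
  fixes C :: "'a::metric_space \<Rightarrow> 'a \<Rightarrow> real"
    and L :: real
    and \<alpha> \<beta> :: "'a measure"
    and fstar gstar :: "'a \<Rightarrow> real"
    and \<eta> :: "nat \<Rightarrow> real"
    and M :: "'w measure"
    and X Y :: "nat \<Rightarrow> 'w \<Rightarrow> 'a"
  assumes "compact (UNIV :: 'a set)"
    and "\<And>x y. C x y = C y x"
    and "L-lipschitz_on UNIV (\<lambda>(x, y). C x y)"
    and "prob_space \<alpha>" "sets \<alpha> = sets borel"
    and "prob_space \<beta>" "sets \<beta> = sets borel"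
    and "optimal_potentials C \<alpha> \<beta> fstar gstar"
    and "\<And>t. t > 0 \<Longrightarrow> 0 \<le> \<eta> t \<and> \<eta> t \<le> 1"
    and "filterlim (\<lambda>T. \<Sum>t = 1..T. \<eta> t) at_top sequentially"
    and "summable (\<lambda>t. (\<eta> t)\<^sup>2)"
    and "prob_space M"
    and "prob_space.indep_vars M (\<lambda>_. borel) X {1..}"
    and "\<And>i. i \<ge> 1 \<Longrightarrow> distr M borel (X i) = \<alpha>"
    and "prob_space.indep_vars M (\<lambda>_. borel) Y {1..}"
    and "\<And>i. i \<ge> 1 \<Longrightarrow> distr M borel (Y i) = \<beta>"
  defines "f \<equiv> \<lambda>n \<omega>. sinkhorn_f C \<eta> (\<lambda>_. n) (\<lambda>i. X i \<omega>) (\<lambda>i. Y i \<omega>)"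
    and "g \<equiv> \<lambda>n \<omega>. sinkhorn_g C \<eta> (\<lambda>_. n) (\<lambda>i. X i \<omega>) (\<lambda>i. Y i \<omega>)"
  shows "(\<exists>A>0. \<forall>n\<ge>1. AE \<omega> in M. \<exists>T>0. \<forall>t>T.
            var_norm (\<lambda>z. f n \<omega> t z - fstar z) + var_norm (\<lambda>z. g n \<omega> t z - gstar z) \<le> A / sqrt (real n))
       \<and> (\<forall>n\<ge>1. \<exists>T>0. \<exists>A>0. \<forall>t>T. AE \<omega> in M.
            var_norm (\<lambda>z. f n \<omega> t z - fstar z) + var_norm (\<lambda>z. g n \<omega> t z - gstar z) \<le> A / sqrt (real n))"
proof -
  have L: "0 \<le> L" by (rule lipschitz_on_nonneg[OF assms(3)])
  have C1: "L-lipschitz_on UNIV (C x)" for x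
    using lipschitz_onD[OF assms(3), of "(x, _)" "(x, _)"]
    by (intro lipschitz_onI L) (simp add: dist_Pair_Pair)
  have C2: "L-lipschitz_on UNIV (\<lambda>x. C x y)" for y
  proof -
    have eq: "(\<lambda>x. C x y) = C y" by (intro ext assms(2))
    show ?thesis unfolding eq by (rule C1)
  qed
  have C_cont: "continuous_on UNIV (C z)" for z by (rule lipschitz_on_continuous_on[OF C1])
  have cont: "continuous_on UNIV fstar" "continuous_on UNIV gstar"
    and fix_f: "fstar = soft_C_transform C \<beta> gstar" and fix_g: "gstar = soft_C_transform C \<alpha> fstar"
    using assms(8) unfolding optimal_potentials_def by blast+
  note star_f = exp_soft_C_transform[OF assms(1,6,7) C1 C2 cont(2), folded fix_f]
  note star_g = exp_soft_C_transform[OF assms(1,4,5) C1 C2 cont(1), folded fix_g]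
  interpret step_sizes \<eta> using assms(9-11) by unfold_locales auto
  define p where "p n \<omega> t x = exp (fstar x) * exp (- f n \<omega> t x)" for n \<omega> t x
  define q where "q n \<omega> t x = exp (gstar x) * exp (- g n \<omega> t x)" for n \<omega> t x
  have lip: "log_lipschitz L (\<lambda>z. exp (- f n \<omega> t z))" "log_lipschitz L (\<lambda>z. exp (- g n \<omega> t z))"
    if "1 \<le> n" "0 < t" for n \<omega> t
    using sinkhorn_log_lipschitz[OF C1 C2 assms(9,2) that] by (auto simp: f_def g_def)
  have lip_pq: "log_lipschitz (2 * L) (p n \<omega> t)" "log_lipschitz (2 * L) (q n \<omega> t)"
    if "1 \<le> n" "0 < t" for n \<omega> t
    unfolding p_def[abs_def] q_def[abs_def] mult_2
    by (intro log_lipschitz_mult star_f star_g lip that)+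
  have var: "var_norm (\<lambda>z. f n \<omega> t z - fstar z) + var_norm (\<lambda>z. g n \<omega> t z - gstar z) \<le> 2 * c"
    if "\<And>x y. p n \<omega> t x \<le> exp c * p n \<omega> t y" "\<And>x y. q n \<omega> t x \<le> exp c * q n \<omega> t y" for n \<omega> t c
  proof -
    have "var_norm (\<lambda>z. f n \<omega> t z - fstar z) \<le> c" "var_norm (\<lambda>z. g n \<omega> t z - gstar z) \<le> c"
      using that by (auto intro!: var_norm_le simp: p_def q_def exp_diff exp_minus field_simps)
    then show ?thesis by simp
  qed
  have "AE \<omega> in M. \<exists>T>0. \<forall>t>T.
      var_norm (\<lambda>z. f n \<omega> t z - fstar z) + var_norm (\<lambda>z. g n \<omega> t z - gstar z) \<le> 1 / sqrt (real n)"
    if n: "1 \<le> n" for n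
  proof -
    define I where "I = batch (\<lambda>_. n)"
    have I: "I s \<subseteq> {1..}" "finite (I s)" "I s \<noteq> {}" for s using n by (auto simp: I_def)
    have disj: "I s \<inter> I t = {}" if "s \<noteq> t" for s t unfolding I_def using that by (rule batches_disjoint)
    have "AE \<omega> in M. equidistributed (2 * (2 * L)) I (\<lambda>i. X i \<omega>) \<alpha>"
      using L by (intro AE_equidistributed assms I disj) auto
    moreover have "AE \<omega> in M. equidistributed (2 * (2 * L)) I (\<lambda>i. Y i \<omega>) \<beta>"
      using L by (intro AE_equidistributed assms I disj) auto
    ultimately show ?thesis
    proof eventually_elim
      case (elim \<omega>)
      define xs ys where "xs = (\<lambda>i. X i \<omega>)" and "ys = (\<lambda>i. Y i \<omega>)"
      \<comment> \<open>The density of the optimal transport plan with respect to the product of \<open>\<alpha>\<close> and \<open>\<beta>\<close>.\<close>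
      define k where "k u v = exp (fstar u + gstar v - C u v)" for u v
      have k_lip: "log_lipschitz (2 * L) (\<lambda>v. k u v)" "log_lipschitz (2 * L) (\<lambda>u. k u v)" for u v
      proof -
        have C_exp: "log_lipschitz L (\<lambda>z. exp (- C w z))" "log_lipschitz L (\<lambda>z. exp (- C z w))" for w
          by (intro log_lipschitz_exp lipschitz_on_minus C1 C2)+
        have "k u = (\<lambda>v. exp (fstar u) * (exp (gstar v) * exp (- C u v)))" for u
          by (rule ext) (simp add: k_def flip: exp_add)
        then show "log_lipschitz (2 * L) (\<lambda>v. k u v)"
          unfolding mult_2 by (simp only:) (intro log_lipschitz_scale log_lipschitz_mult star_g C_exp, simp)
        have "(\<lambda>u. k u v) = (\<lambda>u. exp (gstar v) * (exp (fstar u) * exp (- C u v)))" for v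
          by (rule ext) (simp add: k_def flip: exp_add)
        then show "log_lipschitz (2 * L) (\<lambda>u. k u v)"
          unfolding mult_2 by (simp only:) (intro log_lipschitz_scale log_lipschitz_mult star_f C_exp, simp)
      qed
      have f_cont: "continuous_on UNIV (f n \<omega> t)" and g_cont: "continuous_on UNIV (g n \<omega> t)" if "0 < t" for t
      proof -
        have "continuous_on UNIV (\<lambda>z. - ln (exp (- f n \<omega> t z)))" "continuous_on UNIV (\<lambda>z. - ln (exp (- g n \<omega> t z)))"
          using log_lipschitz_ln[OF lip(1)[OF n that] L] log_lipschitz_ln[OF lip(2)[OF n that] L]
          by (auto intro!: continuous_on_minus lipschitz_on_continuous_on)
        then show "continuous_on UNIV (f n \<omega> t)" "continuous_on UNIV (g n \<omega> t)" by simp_all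
      qed
      have p_step: "p n \<omega> (Suc t) z = (1 - \<eta> t) * p n \<omega> t z + \<eta> t * batch_mean ys (I t) (\<lambda>w. k z w / q n \<omega> t w)"
        if t: "0 < t" for t z
      proof -
        have "k z w / q n \<omega> t w = exp (fstar z) * exp (g n \<omega> t w - C z w)" for w
          unfolding k_def q_def by (simp add: algebra_simps flip: exp_add exp_diff)
        then have "batch_mean ys (I t) (\<lambda>w. k z w / q n \<omega> t w)
            = exp (fstar z) * exp (- soft_C_transform C (empirical (\<lambda>_. n) ys t) (g n \<omega> t) z)"
          using soft_C_transform_batch[where n = n and x = ys and t = t and z = z, OF g_cont[OF t] C_cont] n
          by (simp only: batch_mean_cmult I_def)
        then show ?thesis
          using online_sinkhorn_step(1)[of t \<eta> C "\<lambda>_. n" xs ys z] t assms(9)[OF t]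
          by (simp add: p_def f_def g_def xs_def ys_def ring_distribs mult_ac)
      qed
      have q_step: "q n \<omega> (Suc t) z = (1 - \<eta> t) * q n \<omega> t z + \<eta> t * batch_mean xs (I t) (\<lambda>w. k w z / p n \<omega> t w)"
        if t: "0 < t" for t z
      proof -
        have "k w z / p n \<omega> t w = exp (gstar z) * exp (f n \<omega> t w - C z w)" for w
          unfolding k_def p_def assms(2)[of w z] by (simp add: algebra_simps flip: exp_add exp_diff)
        then have "batch_mean xs (I t) (\<lambda>w. k w z / p n \<omega> t w)
            = exp (gstar z) * exp (- soft_C_transform C (empirical (\<lambda>_. n) xs t) (f n \<omega> t) z)"
          using soft_C_transform_batch[where n = n and x = xs and t = t and z = z, OF f_cont[OF t] C_cont] n
          by (simp only: batch_mean_cmult I_def)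
        then show ?thesis
          using online_sinkhorn_step(2)[of t \<eta> C "\<lambda>_. n" xs ys z] t assms(9)[OF t]
          by (simp add: q_def f_def g_def xs_def ys_def ring_distribs mult_ac)
      qed
      have k_\<alpha>: "(LINT u|\<alpha>. k u v) = 1" for v
      proof -
        have "k u v = exp (gstar v + fstar u - C v u)" for u
          unfolding k_def assms(2)[of u v] by (simp add: add.commute)
        then show ?thesis using star_g(2)[of v] by simp
      qed
      have k_\<beta>: "(LINT v|\<beta>. k u v) = 1" for u
        unfolding k_def by (rule star_f(2))
      have "sinkhorn_dynamics \<eta> k (2 * L) \<alpha> \<beta> I xs ys (p n \<omega>) (q n \<omega>)"
      proof (intro sinkhorn_dynamics.intro sinkhorn_dynamics_axioms.intro)
        show "step_sizes \<eta>" by (rule step_sizes_axioms)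
        show "0 \<le> 2 * L" using L by simp
        show "log_lipschitz (2 * L) (p n \<omega> 1)" "log_lipschitz (2 * L) (q n \<omega> 1)" using n by (intro lip_pq; simp)+
        show "equidistributed (2 * (2 * L)) I xs \<alpha>" "equidistributed (2 * (2 * L)) I ys \<beta>"
          using elim by (simp_all add: xs_def ys_def)
      qed (fact assms(1) assms(4-7) k_lip k_\<alpha> k_\<beta> I p_step q_step)+
      then interpret D: sinkhorn_dynamics \<eta> k "2 * L" \<alpha> \<beta> I xs ys "p n \<omega>" "q n \<omega>" .
      \<comment> \<open>Each of the two variation norms receives half of the bound.\<close>
      define \<epsilon> where "\<epsilon> = 1 / (2 * sqrt (real n))"
      have \<epsilon>: "0 < \<epsilon>" using n by (simp add: \<epsilon>_def)
      obtain T where T: "\<And>t. T \<le> t \<Longrightarrow> ratio_le \<epsilon> (p n \<omega> t) \<and> ratio_le \<epsilon> (q n \<omega> t)"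
        using D.eventually_almost_constant[OF \<epsilon>] by (auto simp: eventually_sequentially)
      have bound: "var_norm (\<lambda>z. f n \<omega> t z - fstar z) + var_norm (\<lambda>z. g n \<omega> t z - gstar z) \<le> 1 / sqrt (real n)"
        if "T < t" for t
      proof -
        have r: "\<phi> u \<le> exp \<epsilon> * \<phi> v" if "ratio_le \<epsilon> \<phi>" "0 < \<phi> v" for \<phi> :: "'a \<Rightarrow> real" and u v
          by (rule order_trans[OF ratio_leD[OF that(1), of u v]])
            (use that(2) in \<open>intro mult_right_mono exp_ge_add_one_self; simp\<close>)
        have "0 < p n \<omega> t v" "0 < q n \<omega> t v" for v by (simp_all add: p_def q_def)
        then have "var_norm (\<lambda>z. f n \<omega> t z - fstar z) + var_norm (\<lambda>z. g n \<omega> t z - gstar z) \<le> 2 * \<epsilon>"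
          using T[of t] that by (intro var r) auto
        then show ?thesis by (simp add: \<epsilon>_def)
      qed
      then show ?case by (intro exI[of _ "Suc T"]) auto
    qed
  qed
  then have "\<exists>A>0. \<forall>n\<ge>1. AE \<omega> in M. \<exists>T>0. \<forall>t>T.
      var_norm (\<lambda>z. f n \<omega> t z - fstar z) + var_norm (\<lambda>z. g n \<omega> t z - gstar z) \<le> A / sqrt (real n)"
    by (intro exI[of _ 1]) auto
  moreover have "\<exists>T>0. \<exists>A>0. \<forall>t>T. AE \<omega> in M.
      var_norm (\<lambda>z. f n \<omega> t z - fstar z) + var_norm (\<lambda>z. g n \<omega> t z - gstar z) \<le> A / sqrt (real n)"
    if n: "1 \<le> n" for n
  proof -
    \<comment> \<open>The quotients of the values of \<open>p\<close> and of \<open>q\<close> are at most \<open>exp c\<close> at all times.\<close>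
    define c where "c = 2 * L * diameter (UNIV :: 'a set)"
    have c: "0 \<le> c" using L diameter_ge_0[OF compact_imp_bounded[OF assms(1)]] by (simp add: c_def)
    define A where "A = (2 * c + 1) * sqrt (real n)"
    have "var_norm (\<lambda>z. f n \<omega> t z - fstar z) + var_norm (\<lambda>z. g n \<omega> t z - gstar z) \<le> A / sqrt (real n)"
      if "0 < t" for \<omega> t
    proof -
      have d: "dist u v \<le> diameter (UNIV :: 'a set)" for u v :: 'a
        using compact_imp_bounded[OF assms(1)] by (intro diameter_bounded_bound) auto
      have "var_norm (\<lambda>z. f n \<omega> t z - fstar z) + var_norm (\<lambda>z. g n \<omega> t z - gstar z) \<le> 2 * c"
        unfolding c_def using L n that d by (intro var log_lipschitz_le lip_pq) auto
      then show ?thesis using n by (simp add: A_def)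
    qed
    moreover have "0 < A" using c n by (simp add: A_def)
    ultimately show ?thesis by (intro exI[of _ 1] exI[of _ A]) auto
  qed
  ultimately show ?thesis by blast
qed

end
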